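(* Let $X$ be a holomorphic vector field on a neighborhood of $(0,0)\in\mathbb{C}^2$ of the form $$X=(\lambda_1x_1+\varphi_1(x_1,x_2))\frac{\partial}{\partial x_1}+(\lambda_2x_2+\varphi_2(x_1,x_2))\frac{\partial}{\partial x_2},$$ where $\lambda_1,\lambda_2\in\mathbb{C}^*$ and $\varphi_1,\varphi_2$ are holomorphic functions of order at least $2$ at the origin. If $\lambda_1/\lambda_2\in\mathbb{R}_-$, then there is an analytic change of coordinates in which $$X=\lambda_1y_1\,[1+(\mathrm{h.o.t.})]\frac{\partial}{\partial y_1}+\lambda_2y_2\,[1+(\mathrm{h.o.t.})]\frac{\partial}{\partial y_2}.$$ In particular $X$ has two smooth transverse separatrices.
   Context: $\mathbb{R}_-$ denotes the negative real numbers. "h.o.t." stands for a holomorphic function of $(y_1,y_2)$ vanishing at the origin (possibly different in the two components). A separatrix of $X$ (or of the associated foliation) at the singular point $(0,0)$ is an irreducible germ of analytic curve through $(0,0)$ invariant by the foliation associated to $X$. An analytic change of coordinates is a local holomorphic diffeomorphism of $(\mathbb{C}^2,0)$ fixing the origin. *)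

theory Defs
  imports "HOL-Analysis.Analysis"
begin

type_synonym C2 = "complex \<times> complex"

text \<open>Holomorphy in two variables: the real Frechet derivative exists at every point of the
  (always open) domain and is complex linear.\<close>

definition holo_on :: "(C2 \<Rightarrow> complex) \<Rightarrow> C2 set \<Rightarrow> bool" where
  "holo_on f U \<longleftrightarrow> open U \<and> (\<forall>p\<in>U. \<exists>a b. (f has_derivative (\<lambda>(u, v). a * u + b * v)) (at p))"

definition holo_map_on :: "(C2 \<Rightarrow> C2) \<Rightarrow> C2 set \<Rightarrow> bool" where
  "holo_map_on F U \<longleftrightarrow> holo_on (\<lambda>p. fst (F p)) U \<and> holo_on (\<lambda>p. snd (F p)) U"

text \<open>No terms of degree 0 or 1 in the Taylor expansion at the origin.\<close>

definition order_ge_2 :: "(C2 \<Rightarrow> complex) \<Rightarrow> bool" where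
  "order_ge_2 f \<longleftrightarrow> f 0 = 0 \<and> (f has_derivative (\<lambda>_. 0)) (at 0)"

definition higher_order_terms_on :: "(C2 \<Rightarrow> complex) \<Rightarrow> C2 set \<Rightarrow> bool" where
  "higher_order_terms_on h W \<longleftrightarrow> holo_on h W \<and> h 0 = 0"

text \<open>\<open>\<Phi>\<close> gives the new coordinates \<open>y = \<Phi> x\<close>, defined for \<open>x \<in> V\<close> and ranging over \<open>W\<close>.\<close>

definition coordinate_change :: "(C2 \<Rightarrow> C2) \<Rightarrow> C2 set \<Rightarrow> C2 set \<Rightarrow> bool" where
  "coordinate_change \<Phi> V W \<longleftrightarrow>
     0 \<in> V \<and> \<Phi> 0 = 0 \<and> bij_betw \<Phi> V W \<and>
     holo_map_on \<Phi> V \<and> holo_map_on (the_inv_into V \<Phi>) W"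

text \<open>The vector field \<open>X\<close>, written in the coordinates \<open>y = \<Phi> x\<close>, is \<open>Y\<close>; that is,
  the push-forward of \<open>X\<close> by \<open>\<Phi>\<close> is \<open>Y\<close>.\<close>

definition expressed_as :: "(C2 \<Rightarrow> C2) \<Rightarrow> (C2 \<Rightarrow> C2) \<Rightarrow> C2 set \<Rightarrow> (C2 \<Rightarrow> C2) \<Rightarrow> bool" where
  "expressed_as X \<Phi> V Y \<longleftrightarrow> (\<forall>x\<in>V. frechet_derivative \<Phi> (at x) (X x) = Y (\<Phi> x))"

text \<open>Germs of sets at the origin are represented by sets; all notions below that concern germs
  depend only on the set near the origin.\<close>

definition germ_eq :: "C2 set \<Rightarrow> C2 set \<Rightarrow> bool" where
  "germ_eq A B \<longleftrightarrow> (\<forall>\<^sub>F p in nhds 0. p \<in> A \<longleftrightarrow> p \<in> B)"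

definition analytic_germ :: "C2 set \<Rightarrow> bool" where
  "analytic_germ A \<longleftrightarrow>
     (\<exists>U F. open U \<and> 0 \<in> U \<and> finite F \<and> (\<forall>f\<in>F. holo_on f U) \<and>
            A \<inter> U = {p\<in>U. \<forall>f\<in>F. f p = 0})"

text \<open>A germ of analytic curve through the origin: the zero set of one holomorphic germ that
  vanishes at the origin and is not identically zero near it.\<close>

definition analytic_curve_germ :: "C2 set \<Rightarrow> bool" where
  "analytic_curve_germ C \<longleftrightarrow>
     (\<exists>U f. 0 \<in> U \<and> holo_on f U \<and> f 0 = 0 \<and> (\<exists>\<^sub>F p in nhds 0. f p \<noteq> 0) \<and>
            C \<inter> U = {p\<in>U. f p = 0})"

definition irreducible_germ :: "C2 set \<Rightarrow> bool" where
  "irreducible_germ C \<longleftrightarrow>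
     (\<forall>A B. analytic_germ A \<and> analytic_germ B \<and> germ_eq C (A \<union> B) \<longrightarrow>
            germ_eq C A \<or> germ_eq C B)"

text \<open>Near \<open>p \<in> C\<close>, the set \<open>C\<close> is the zero set of a holomorphic \<open>f\<close> whose differential
  \<open>a du + b dv\<close> at \<open>p\<close> is nonzero.\<close>

definition regular_equation_at ::
    "C2 set \<Rightarrow> C2 \<Rightarrow> (C2 \<Rightarrow> complex) \<Rightarrow> complex \<Rightarrow> complex \<Rightarrow> bool" where
  "regular_equation_at C p f a b \<longleftrightarrow>
     p \<in> C \<and> (\<exists>U. p \<in> U \<and> holo_on f U \<and> C \<inter> U = {q\<in>U. f q = 0}) \<and>
     (f has_derivative (\<lambda>(u, v). a * u + b * v)) (at p) \<and> (a, b) \<noteq> (0, 0)"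

definition smooth_curve_at :: "C2 set \<Rightarrow> C2 \<Rightarrow> bool" where
  "smooth_curve_at C p \<longleftrightarrow> (\<exists>f a b. regular_equation_at C p f a b)"

text \<open>The kernel of the differential, which does not depend on the regular equation chosen.
  Only meaningful at smooth points (it is empty elsewhere).\<close>

definition tangent_line :: "C2 set \<Rightarrow> C2 \<Rightarrow> C2 set" where
  "tangent_line C p = {(u, v). \<exists>f a b. regular_equation_at C p f a b \<and> a * u + b * v = 0}"

text \<open>Invariance by the foliation of \<open>X\<close>: tangency of \<open>X\<close> to \<open>C\<close> at the smooth points of \<open>C\<close>
  near the origin.\<close>

definition invariant_germ :: "(C2 \<Rightarrow> C2) \<Rightarrow> C2 set \<Rightarrow> bool" where
  "invariant_germ X C \<longleftrightarrow>
     (\<forall>\<^sub>F p in nhds 0. smooth_curve_at C p \<longrightarrow> X p \<in> tangent_line C p)"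

definition separatrix :: "(C2 \<Rightarrow> C2) \<Rightarrow> C2 set \<Rightarrow> bool" where
  "separatrix X C \<longleftrightarrow> analytic_curve_germ C \<and> irreducible_germ C \<and> invariant_germ X C"

definition transverse_at_0 :: "C2 set \<Rightarrow> C2 set \<Rightarrow> bool" where
  "transverse_at_0 C D \<longleftrightarrow>
     smooth_curve_at C 0 \<and> smooth_curve_at D 0 \<and> tangent_line C 0 \<inter> tangent_line D 0 = {0}"

end

theory Submission
  imports Defs "HOL-Complex_Analysis.Complex_Analysis"
begin

text \<open>An invariant curve \<open>y = g x\<close> tangent to the first axis, written as \<open>g x = x * w x\<close>, amounts to a
  Briot--Bouquet equation \<open>x * w' + c * w = F x w\<close> with \<open>c = 1 - l2 / l1\<close>. Since \<open>l2 / l1\<close> is negative,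
  \<open>c > 1\<close>, so no resonance occurs: \<open>x d/dx + c\<close> has an inverse of norm at most 1 on bounded holomorphic
  functions, and as \<open>F\<close> is a contraction in \<open>w\<close> for small \<open>x\<close>, Picard iteration produces \<open>w\<close>. Exchanging
  the coordinates gives a second invariant curve \<open>x = h y\<close>. In the coordinates \<open>(x - h y, y - g x)\<close> the two
  curves are the axes, so the components of the field are divisible by the respective coordinates. The
  quotients are holomorphic because they are continuous and separately holomorphic.\<close>

section \<open>The Briot--Bouquet equation\<close>

text \<open>Linearising the field would meet the divisors \<open>n1 * l1 + n2 * l2 - lj\<close>,
  which for a negative ratio vanish or come arbitrarily close to 0. An invariant curve is a
  one-variable problem whose divisors \<open>n + c\<close> are all at least \<open>c > 1\<close>,
  and the normal form asks for no more than two such curves. The constant \<open>c\<close> arises as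
  follows. Tangency of the field to \<open>y = g x\<close> reads
  \<open>l2 * g + \<phi>2 = g' * (l1 * x + \<phi>1)\<close>; with \<open>g = x * w\<close> one has
  \<open>g' = w + x * w'\<close>, the linear part of the field contributes
  \<open>(l2 / l1) * w\<close> to it, and what is left over is \<open>F x w\<close>. At x = 0 the
  equation forces \<open>w 0 = 0\<close>, hence \<open>g' 0 = 0\<close>. This one fact gives the
  coordinate change the identity as derivative at the origin, makes the quotients take exactly the
  values \<open>l1\<close> and \<open>l2\<close> there, and places the tangents of the two curves on
  different axes.\<close>

text \<open>The inverse of the operator \<open>x d/dx + c\<close>: it sends \<open>x ^ n\<close> to \<open>x ^ n / (n + c)\<close>. Only \<open>c > 1\<close> is used,
  where the weight \<open>t powr (c - 1)\<close> is continuous at \<open>t = 0\<close>.\<close>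

definition euler_inverse :: "real \<Rightarrow> (complex \<Rightarrow> complex) \<Rightarrow> complex \<Rightarrow> complex" where
  "euler_inverse c h x = integral {0..1} (\<lambda>t. of_real (t powr (c - 1)) * h (of_real t * x))"

lemma scaled_mem_ball:
  fixes x :: complex
  assumes "x \<in> ball 0 r" "t \<in> {0..1}"
  shows "of_real t * x \<in> ball 0 r"
proof -
  have "norm (of_real t * x) \<le> 1 * norm x"
    unfolding norm_mult using assms by (intro mult_right_mono) auto
  then show ?thesis using assms by auto
qed

lemma continuous_on_euler_integrand:
  fixes h :: "complex \<Rightarrow> complex"
  assumes c: "c > 1" and h: "continuous_on (ball 0 r) h" and x: "x \<in> ball 0 r"
  shows "continuous_on {0..1} (\<lambda>t. of_real (t powr (c - 1)) * h (of_real t * x) :: complex)"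
  using scaled_mem_ball[OF x] c
  by (intro continuous_intros continuous_on_powr' continuous_on_compose2[OF h]) auto

lemma euler_inverse_diff:
  assumes c: "c > 1" and f: "continuous_on (ball 0 r) f" and g: "continuous_on (ball 0 r) g"
    and x: "x \<in> ball 0 r"
  shows "euler_inverse c (\<lambda>x. f x - g x) x = euler_inverse c f x - euler_inverse c g x"
  unfolding euler_inverse_def right_diff_distrib
  by (intro integral_diff integrable_continuous_real continuous_on_euler_integrand[OF c _ x] f g)

text \<open>The weight lies between 0 and 1 on an interval of length 1. Its mass is in fact
  \<open>1 / c\<close>, but the bound 1 suffices: the contraction factor will come from
  \<open>F\<close>.\<close>

lemma norm_euler_inverse_le:
  assumes c: "c > 1" and h: "continuous_on (ball 0 r) h" and x: "x \<in> ball 0 r"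
    and B: "\<And>x. x \<in> ball 0 r \<Longrightarrow> norm (h x) \<le> B"
  shows "norm (euler_inverse c h x) \<le> B"
proof -
  have "norm (of_real (t powr (c - 1)) * h (of_real t * x)) \<le> B" if t: "t \<in> {0..1}" for t
  proof -
    have "t powr (c - 1) \<le> 1" using t c powr_mono2[of "c-1" t 1] by auto
    moreover have "norm (h (of_real t * x)) \<le> B" using B scaled_mem_ball[OF x t] by auto
    ultimately have "t powr (c - 1) * norm (h (of_real t * x)) \<le> 1 * B"
      using t by (intro mult_mono) auto
    then show ?thesis by (simp add: norm_mult)
  qed
  from integral_bound[OF _ continuous_on_euler_integrand[OF c h x] this]
  show ?thesis by (simp add: euler_inverse_def)
qed

text \<open>\<open>D\<close> comes from differentiating under the integral. As x times the
  derivative of \<open>h\<close> at \<open>t * x\<close> is the t-derivative of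
  \<open>h (t * x)\<close>, the product \<open>x * D\<close> is the integral of
  \<open>t powr c\<close> against that t-derivative, and integration by parts leaves the boundary
  value \<open>h x\<close> minus \<open>c\<close> times the integral defining
  \<open>euler_inverse\<close>.\<close>

lemma euler_inverse_derivative:
  assumes c: "c > 1" and h: "h holomorphic_on ball 0 r" and x: "x \<in> ball 0 r"
  obtains D where "(euler_inverse c h has_field_derivative D) (at x)"
    and "x * D = h x - of_real c * euler_inverse c h x"
proof
  note cont = holomorphic_on_imp_continuous_on[OF h]
  note cont' = holomorphic_on_imp_continuous_on[OF holomorphic_deriv[OF h open_ball]]
  have der: "(h has_field_derivative deriv h z) (at z)" if "z \<in> ball 0 r" for z
    using holomorphic_derivI[OF h open_ball that] .
  define D where
    "D = integral {0..1} (\<lambda>t. of_real (t powr (c - 1)) * (of_real t * deriv h (of_real t * x)) :: complex)"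
  have "((\<lambda>x. integral (cbox 0 1) (\<lambda>t. of_real (t powr (c - 1)) * h (of_real t * x)))
      has_field_derivative integral (cbox 0 1)
        (\<lambda>t. of_real (t powr (c - 1)) * (of_real t * deriv h (of_real t * x)))) (at x within ball 0 r)"
  proof (rule leibniz_rule_field_derivative[OF _ _ _ x convex_ball])
    show "((\<lambda>x. of_real (t powr (c - 1)) * h (of_real t * x)) has_field_derivative
           of_real (t powr (c - 1)) * (of_real t * deriv h (of_real t * z))) (at z within ball 0 r)"
      if "z \<in> ball 0 r" "t \<in> cbox 0 1" for z and t :: real
    proof -
      have "((\<lambda>x. h (of_real t * x)) has_field_derivative
             deriv h (of_real t * z) * of_real t) (at z within ball 0 r)"
        using der[OF scaled_mem_ball[of z r t]] that
        by (intro DERIV_chain2[where f = h]) (auto intro!: derivative_eq_intros)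
      from DERIV_cmult[OF this, of "of_real (t powr (c - 1))"] show ?thesis by (simp add: mult.commute)
    qed
    show "(\<lambda>t. of_real (t powr (c - 1)) * h (of_real t * z)) integrable_on cbox 0 1"
      if "z \<in> ball 0 r" for z
      using continuous_on_euler_integrand[OF c cont that] integrable_continuous_real by auto
    show "continuous_on (ball 0 r \<times> cbox 0 1)
           (\<lambda>(x, t). of_real (t powr (c - 1)) * (of_real t * deriv h (of_real t * x)) :: complex)"
      unfolding split_beta using c scaled_mem_ball
      by (intro continuous_intros continuous_on_powr' continuous_on_compose2[OF cont']) auto
  qed
  then show "(euler_inverse c h has_field_derivative D) (at x)"
    using x by (simp add: euler_inverse_def[abs_def] D_def at_within_open[OF _ open_ball])
  have hx: "((\<lambda>t. h (of_real t * x)) has_vector_derivative x * deriv h (of_real t * x)) (at t)"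
    if "t \<in> {0<..<1}" for t :: real
  proof -
    have t: "of_real t * x \<in> ball 0 r" using that by (intro scaled_mem_ball[OF x]) auto
    have "((\<lambda>t. of_real t * x) has_vector_derivative x) (at t)"
      by (auto intro!: derivative_eq_intros simp: has_vector_derivative_def scaleR_conv_of_real)
    from field_vector_diff_chain_at[OF this der[OF t]] show ?thesis by (simp add: o_def)
  qed
  \<comment> \<open>\<open>t powr c\<close> is differentiated only for t > 0; the integration by
    parts below therefore takes derivatives in the open interval and continuity up to the
    ends.\<close>
  have tc: "((\<lambda>t. of_real (t powr c) :: complex) has_vector_derivative
          of_real (c * t powr (c - 1))) (at t)" if "t \<in> {0<..<1}" for t :: real
    using has_real_derivative_powr[of t c] that
    by (intro has_vector_derivative_of_real)
       (auto simp: has_real_derivative_iff_has_vector_derivative)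
  have contD: "continuous_on {0..1} (\<lambda>t. of_real (t powr (c - 1)) * (of_real t * deriv h (of_real t * x)) :: complex)"
    using c scaled_mem_ball[OF x]
    by (intro continuous_intros continuous_on_powr' continuous_on_compose2[OF cont']) auto
  have *: "((\<lambda>t. of_real (t powr (c - 1)) * (of_real t * deriv h (of_real t * x)) :: complex) has_integral D) {0..1}"
    unfolding D_def using integrable_continuous_real[OF contD] by (rule integrable_integral)
  have eq: "t powr (c - 1) * t = t powr c" if "t \<in> {0..1}" for t :: real
    using that c by (cases "t = 0") (auto simp: powr_diff)
  have "((\<lambda>t. of_real (t powr c) * (x * deriv h (of_real t * x)) :: complex) has_integral x * D) {0..1}"
    by (rule has_integral_eq[OF _ has_integral_mult_right[OF *, of x]])
       (use eq in \<open>auto simp flip: of_real_mult simp: mult_ac\<close>)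
  \<comment> \<open>The boundary terms are \<open>h x\<close> at t = 1 and 0 at t = 0, because
    \<open>0 powr c = 0\<close>.\<close>
  then have "((\<lambda>t. of_real (c * t powr (c - 1)) * h (of_real t * x) :: complex) has_integral h x - x * D) {0..1}"
  proof (intro integration_by_parts_interior[OF bounded_bilinear_mult, where
        f = "\<lambda>t. of_real (t powr c)" and g = "\<lambda>t. h (of_real t * x)" and g' = "\<lambda>t. x * deriv h (of_real t * x)"] tc hx)
    show "continuous_on {0..1} (\<lambda>t. complex_of_real (t powr c))"
      using c by (intro continuous_intros continuous_on_powr') auto
    show "continuous_on {0..1} (\<lambda>t. h (complex_of_real t * x))"
      using scaled_mem_ball[OF x] by (intro continuous_on_compose2[OF cont] continuous_intros) auto
  qed (use c in auto)
  moreover have "((\<lambda>t. of_real (c * t powr (c - 1)) * h (of_real t * x) :: complex)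
        has_integral of_real c * euler_inverse c h x) {0..1}"
    using has_integral_mult_right[OF integrable_integral[OF integrable_continuous_real
            [OF continuous_on_euler_integrand[OF c cont x]]], of "of_real c"]
    by (simp add: euler_inverse_def mult.assoc)
  ultimately have "h x - x * D = of_real c * euler_inverse c h x"
    by (rule has_integral_unique)
  then show "x * D = h x - of_real c * euler_inverse c h x" by (simp add: algebra_simps)
qed

lemma holomorphic_on_euler_inverse:
  assumes "c > 1" "h holomorphic_on ball 0 r"
  shows "euler_inverse c h holomorphic_on ball 0 r"
  by (subst holomorphic_on_open) (auto intro: euler_inverse_derivative[OF assms])

text \<open>By \<open>euler_inverse_derivative\<close>, a fixed point of
  \<open>w |-> euler_inverse c (\<lambda>x. F x (w x))\<close> solves the equation. Holomorphy of
  \<open>F\<close> is asked along functions \<open>w\<close>, because the \<open>F\<close> to which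
  this is applied is defined by cases at x = 0.\<close>

lemma briot_bouquet:
  fixes F :: "complex \<Rightarrow> complex \<Rightarrow> complex"
  assumes c: "c > 1"
    and hol: "\<And>w. w holomorphic_on ball 0 r \<Longrightarrow> (\<And>x. x \<in> ball 0 r \<Longrightarrow> norm (w x) \<le> 1) \<Longrightarrow>
               (\<lambda>x. F x (w x)) holomorphic_on ball 0 r"
    and bound: "\<And>x w. x \<in> ball 0 r \<Longrightarrow> norm w \<le> 1 \<Longrightarrow> norm (F x w) \<le> 1"
    and lip: "\<And>x v w. x \<in> ball 0 r \<Longrightarrow> norm v \<le> 1 \<Longrightarrow> norm w \<le> 1 \<Longrightarrow>
               norm (F x v - F x w) \<le> norm (v - w) / 2"
  obtains w where "w holomorphic_on ball 0 r" "\<And>x. x \<in> ball 0 r \<Longrightarrow> norm (w x) \<le> 1"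
    "\<And>x. x \<in> ball 0 r \<Longrightarrow> x * deriv w x = F x (w x) - of_real c * w x"
proof -
  define good where "good w \<longleftrightarrow> w holomorphic_on ball 0 r \<and> (\<forall>x\<in>ball 0 r. norm (w x) \<le> 1)" for w
  define T where "T w = euler_inverse c (\<lambda>x. F x (w x))" for w
  have goodF: "(\<lambda>x. F x (w x)) holomorphic_on ball 0 r" if "good w" for w
    using that hol by (auto simp: good_def)
  note contF = holomorphic_on_imp_continuous_on[OF goodF]
  have goodT: "good (T w)" if "good w" for w
    unfolding good_def T_def using that bound
    by (auto simp: good_def intro!: holomorphic_on_euler_inverse[OF c goodF]
        norm_euler_inverse_le[where r = r, OF c contF])
  have lipT: "norm (T v x - T w x) \<le> B / 2"
    if "good v" "good w" "\<And>x. x \<in> ball 0 r \<Longrightarrow> norm (v x - w x) \<le> B" "x \<in> ball 0 r" for v w x B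
  proof -
    have "norm (F z (v z) - F z (w z)) \<le> B / 2" if "z \<in> ball 0 r" for z
      using lip[OF that, of "v z" "w z"] \<open>good v\<close> \<open>good w\<close> that(1) \<open>\<And>x. x \<in> ball 0 r \<Longrightarrow> norm (v x - w x) \<le> B\<close>[OF that]
      by (auto simp: good_def)
    then show ?thesis
      unfolding T_def euler_inverse_diff[OF c contF[OF \<open>good v\<close>] contF[OF \<open>good w\<close>] \<open>x \<in> ball 0 r\<close>, symmetric]
      using that by (intro norm_euler_inverse_le[OF c _ \<open>x \<in> ball 0 r\<close>] continuous_intros contF) auto
  qed
  define W where "W n = (T ^^ n) (\<lambda>_. 0)" for n
  have W0: "W 0 = (\<lambda>_. 0)" and WSuc: "W (Suc n) = T (W n)" for n by (auto simp: W_def)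
  have goodW: "good (W n)" for n
    by (induction n) (auto simp: W0 WSuc goodT, simp add: good_def)
  \<comment> \<open>The first difference is \<open>W 1\<close> itself, bounded by 1 as a good
    function; \<open>lipT\<close> halves each further one.\<close>
  have diffW: "\<forall>x\<in>ball 0 r. norm (W (Suc n) x - W n x) \<le> (1/2) ^ n" for n
  proof (induction n)
    case 0
    show ?case using goodW[of 1] by (auto simp: W0 good_def)
  next
    case (Suc n)
    then show ?case
      using lipT[OF goodW[of "Suc n"] goodW[of n], of "(1/2)^n"] by (auto simp: WSuc)
  qed
  \<comment> \<open>Written as a telescoping series, the limit is within reach of the Weierstrass
    M-test with majorant \<open>(1/2) ^ n\<close>.\<close>
  define w where "w x = (\<Sum>i. W (Suc i) x - W i x)" for x
  have sumW: "(\<lambda>n x. \<Sum>i<n. W (Suc i) x - W i x) = W"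
    using sum_lessThan_telescope[of "\<lambda>i. W i x" for x] by (auto simp: fun_eq_iff W0)
  have "uniform_limit (ball 0 r) (\<lambda>n x. \<Sum>i<n. W (Suc i) x - W i x) w sequentially"
    unfolding w_def using diffW by (intro Weierstrass_m_test[where M = "\<lambda>n. (1/2)^n"]) auto
  then have lim: "uniform_limit (ball 0 r) W w sequentially" by (simp only: sumW)
  have limx: "(\<lambda>n. W n x) \<longlonglongrightarrow> w x" if "x \<in> ball 0 r" for x
    using tendsto_uniform_limitI[OF lim that] .
  have "w holomorphic_on ball 0 r"
  proof (rule holomorphic_uniform_sequence[OF open_ball])
    show "W n holomorphic_on ball 0 r" for n using goodW by (auto simp: good_def)
    show "\<exists>d>0. cball x d \<subseteq> ball 0 r \<and> uniform_limit (cball x d) W w sequentially" if "x \<in> ball 0 r" for x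
      using that open_ball[of 0 r] by (meson lim open_contains_cball uniform_limit_on_subset)
  qed
  moreover have "norm (w x) \<le> 1" if "x \<in> ball 0 r" for x
    using goodW that by (intro LIMSEQ_le_const2[OF tendsto_norm[OF limx[OF that]]]) (auto simp: good_def)
  ultimately have w: "good w" by (auto simp: good_def)
  \<comment> \<open>\<open>lipT\<close> carries the uniform convergence through \<open>T\<close>, so
    the shifted iterates tend both to \<open>w\<close> and to \<open>T w\<close>.\<close>
  have fix_w: "w x = T w x" if x: "x \<in> ball 0 r" for x
  proof (rule LIMSEQ_unique)
    show "(\<lambda>n. W (Suc n) x) \<longlonglongrightarrow> w x" using limx[OF x] by (rule LIMSEQ_Suc)
    show "(\<lambda>n. W (Suc n) x) \<longlonglongrightarrow> T w x"
    proof (rule tendstoI)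
      fix e :: real assume "e > 0"
      from uniform_limitD[OF lim this]
      show "\<forall>\<^sub>F n in sequentially. dist (W (Suc n) x) (T w x) < e"
      proof eventually_elim
        case (elim n)
        then have "norm (T (W n) x - T w x) \<le> e / 2"
          by (intro lipT[OF goodW w _ x]) (auto simp: dist_norm intro: less_imp_le)
        then show ?case using \<open>e > 0\<close> by (simp add: WSuc dist_norm)
      qed
    qed
  qed
  show ?thesis
  proof
    show "norm (w x) \<le> 1" if "x \<in> ball 0 r" for x
      using w that by (auto simp: good_def)
    show "w holomorphic_on ball 0 r" using w by (auto simp: good_def)
    show "x * deriv w x = F x (w x) - of_real c * w x" if x: "x \<in> ball 0 r" for x
    proof -
      obtain D where D: "(T w has_field_derivative D) (at x)" "x * D = F x (w x) - of_real c * T w x"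
        unfolding T_def by (rule euler_inverse_derivative[OF c goodF[OF w] x])
      have "(w has_field_derivative D) (at x)"
        by (rule has_field_derivative_transform_within_open[OF D(1) open_ball x]) (simp add: fix_w)
      from DERIV_imp_deriv[OF this] D(2) show ?thesis using fix_w[OF x] by simp
    qed
  qed
qed

section \<open>Holomorphic functions of two variables\<close>

lemma holo_onD:
  assumes "holo_on f U" "p \<in> U"
  obtains a b where "(f has_derivative (\<lambda>(u, v). a * u + b * v)) (at p)"
  using assms by (auto simp: holo_on_def)

lemma holo_onI:
  assumes "open U" "\<And>p. p \<in> U \<Longrightarrow> (f has_derivative D p) (at p)"
    and "\<And>p u v. p \<in> U \<Longrightarrow> D p (u, v) = a p * u + b p * v"
  shows "holo_on f U"
proof -
  have "D p = (\<lambda>(u, v). a p * u + b p * v)" if "p \<in> U" for p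
    using assms(3)[OF that] by auto
  then show ?thesis using assms(1,2) unfolding holo_on_def by metis
qed

lemma holo_on_imp_continuous_on: "holo_on f U \<Longrightarrow> continuous_on U f"
  by (meson continuous_at_imp_continuous_on has_derivative_continuous holo_onD)

lemma holo_on_subset: "holo_on f U \<Longrightarrow> open V \<Longrightarrow> V \<subseteq> U \<Longrightarrow> holo_on f V"
  by (auto simp: holo_on_def)

lemma holo_on_cong: "holo_on f U \<Longrightarrow> (\<And>p. p \<in> U \<Longrightarrow> f p = g p) \<Longrightarrow> holo_on g U"
  unfolding holo_on_def by (meson has_derivative_transform_within_open)

lemma has_field_derivative_curve:
  assumes "(f has_derivative (\<lambda>(u, v). a * u + b * v)) (at (x s, y s))"
    and "(x has_field_derivative x') (at s)" "(y has_field_derivative y') (at s)"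
  shows "((\<lambda>s. f (x s, y s)) has_field_derivative a * x' + b * y') (at s)"
proof -
  have "((\<lambda>s. (x s, y s)) has_derivative (\<lambda>h. (x' * h, y' * h))) (at s)"
    using assms(2,3) by (auto simp: has_field_derivative_def intro: has_derivative_Pair)
  from has_derivative_compose[OF this assms(1)] show ?thesis
    unfolding has_field_derivative_def
    by (rule has_derivative_eq_rhs) (simp add: fun_eq_iff distrib_right mult.assoc)
qed

lemma holo_on_curve:
  assumes "holo_on f U" "x holomorphic_on S" "y holomorphic_on S" "open S"
    and "\<And>s. s \<in> S \<Longrightarrow> (x s, y s) \<in> U"
  shows "(\<lambda>s. f (x s, y s)) holomorphic_on S"
proof (subst holomorphic_on_open[OF \<open>open S\<close>], intro ballI)
  fix s assume s: "s \<in> S"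
  obtain a b where "(f has_derivative (\<lambda>(u, v). a * u + b * v)) (at (x s, y s))"
    by (rule holo_onD[OF assms(1) assms(5)[OF s]])
  from has_field_derivative_curve[where x = x and y = y, OF this] assms(2,3) s show "\<exists>D. ((\<lambda>s. f (x s, y s)) has_field_derivative D) (at s)"
    by (meson \<open>open S\<close> holomorphic_derivI)
qed

lemma holo_on_const: "open U \<Longrightarrow> holo_on (\<lambda>_. c) U"
  by (rule holo_onI[where D = "\<lambda>_ _. 0" and a = "\<lambda>_. 0" and b = "\<lambda>_. 0"]) auto

lemma holo_on_compose_holomorphic:
  assumes "h holomorphic_on S" "open S" "holo_on f U" "f ` U \<subseteq> S"
  shows "holo_on (\<lambda>p. h (f p)) U"
  unfolding holo_on_def
proof (intro conjI ballI)
  show "open U" using assms by (simp add: holo_on_def)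
  fix p assume p: "p \<in> U"
  obtain a b where ab: "(f has_derivative (\<lambda>(u, v). a * u + b * v)) (at p)"
    by (rule holo_onD[OF assms(3) p])
  have "(h has_field_derivative deriv h (f p)) (at (f p))"
    using assms p by (intro holomorphic_derivI) auto
  from has_derivative_compose[OF ab this[unfolded has_field_derivative_def]]
  show "\<exists>a b. ((\<lambda>p. h (f p)) has_derivative (\<lambda>(u, v). a * u + b * v)) (at p)"
    by - (rule exI[of _ "deriv h (f p) * a"], rule exI[of _ "deriv h (f p) * b"],
       erule has_derivative_eq_rhs, simp add: fun_eq_iff algebra_simps)
qed

lemma holo_on_compose:
  assumes "holo_on f U" "holo_on g V" "holo_on h V" "\<And>p. p \<in> V \<Longrightarrow> (g p, h p) \<in> U"
  shows "holo_on (\<lambda>p. f (g p, h p)) V"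
  unfolding holo_on_def
proof (intro conjI ballI)
  show "open V" using assms by (simp add: holo_on_def)
  fix p assume p: "p \<in> V"
  obtain a b where ab: "(f has_derivative (\<lambda>(u, v). a * u + b * v)) (at (g p, h p))"
    by (rule holo_onD[OF assms(1) assms(4)[OF p]])
  obtain c d where cd: "(g has_derivative (\<lambda>(u, v). c * u + d * v)) (at p)"
    by (rule holo_onD[OF assms(2) p])
  obtain c' d' where cd': "(h has_derivative (\<lambda>(u, v). c' * u + d' * v)) (at p)"
    by (rule holo_onD[OF assms(3) p])
  from has_derivative_compose[OF has_derivative_Pair[OF cd cd'] ab]
  show "\<exists>a b. ((\<lambda>p. f (g p, h p)) has_derivative (\<lambda>(u, v). a * u + b * v)) (at p)"
    by - (rule exI[of _ "a * c + b * c'"], rule exI[of _ "a * d + b * d'"],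
       erule has_derivative_eq_rhs, simp add: fun_eq_iff algebra_simps)
qed

lemma holo_on_fst: "open U \<Longrightarrow> holo_on fst U"
  by (rule holo_onI[where D = "\<lambda>_. fst" and a = "\<lambda>_. 1" and b = "\<lambda>_. 0"])
     (auto intro!: derivative_eq_intros)

lemma holo_on_snd: "open U \<Longrightarrow> holo_on snd U"
  by (rule holo_onI[where D = "\<lambda>_. snd" and a = "\<lambda>_. 0" and b = "\<lambda>_. 1"])
     (auto intro!: derivative_eq_intros)

text \<open>Arithmetic is treated as composition with a polynomial in two variables whose derivative
  is explicit.\<close>

lemma holo_on_diff:
  assumes "holo_on f U" "holo_on g U"
  shows "holo_on (\<lambda>p. f p - g p) U"
proof -
  have "holo_on (\<lambda>p. fst p - snd p) UNIV"
    by (rule holo_onI[where D = "\<lambda>_ p. fst p - snd p" and a = "\<lambda>_. 1" and b = "\<lambda>_. -1"])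
       (auto intro!: derivative_eq_intros)
  from holo_on_compose[OF this assms] show ?thesis by simp
qed

lemma holo_on_mult:
  assumes "holo_on f U" "holo_on g U"
  shows "holo_on (\<lambda>p. f p * g p) U"
proof -
  have "holo_on (\<lambda>p. fst p * snd p) UNIV"
    by (rule holo_onI[where D = "\<lambda>p q. fst p * snd q + fst q * snd p" and a = snd and b = fst])
       (auto intro!: derivative_eq_intros)
  from holo_on_compose[OF this assms] show ?thesis by simp
qed

lemma holo_on_add:
  assumes "holo_on f U" "holo_on g U"
  shows "holo_on (\<lambda>p. f p + g p) U"
  using holo_on_diff[OF assms(1) holo_on_diff[OF holo_on_const assms(2)], of 0] assms
  by (simp add: holo_on_def)

lemma holo_on_swap:
  assumes "holo_on f U"
  shows "holo_on (\<lambda>p. f (prod.swap p)) (prod.swap -` U)"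
proof -
  have "open (prod.swap -` U)"
    using assms by (intro open_vimage continuous_intros) (auto simp: holo_on_def prod.swap_def)
  then show ?thesis
    using holo_on_compose[OF assms holo_on_snd holo_on_fst, of "prod.swap -` U"]
    by (auto simp: prod.swap_def split_beta)
qed

section \<open>Osgood's lemma: continuity and separate holomorphy give holomorphy\<close>

lemma open_prod_contains_cballs:
  fixes U :: "('a::metric_space \<times> 'b::metric_space) set"
  assumes "open U" "(x, y) \<in> U"
  obtains r where "r > 0" "cball x r \<times> cball y r \<subseteq> U"
proof -
  obtain A B where AB: "open A" "open B" "(x, y) \<in> A \<times> B" "A \<times> B \<subseteq> U"
    using assms by (rule open_prod_elim)
  obtain a b where "a > 0" "cball x a \<subseteq> A" "b > 0" "cball y b \<subseteq> B"
    using AB open_contains_cball by (metis mem_Sigma_iff)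
  then have "min a b > 0" "cball x (min a b) \<times> cball y (min a b) \<subseteq> U"
    using AB by (auto simp: subset_iff)
  then show ?thesis using that by blast
qed

text \<open>Heine--Cantor on a compact product, one coordinate at a time. Moving x serves the Cauchy
  estimate for the y-derivative and the uniform limit of slices; moving y serves the continuity of
  the quotient on the axis.\<close>

lemma uniformly_close_slices:
  fixes f :: "'a::metric_space \<times> 'b::metric_space \<Rightarrow> 'c::metric_space"
  assumes "continuous_on (A \<times> B) f" "compact A" "compact B" "e > 0"
  obtains d where "d > 0"
    "\<And>x x' y. x \<in> A \<Longrightarrow> x' \<in> A \<Longrightarrow> y \<in> B \<Longrightarrow> dist x x' < d \<Longrightarrow> dist (f (x, y)) (f (x', y)) < e"
    "\<And>x y y'. x \<in> A \<Longrightarrow> y \<in> B \<Longrightarrow> y' \<in> B \<Longrightarrow> dist y y' < d \<Longrightarrow> dist (f (x, y)) (f (x, y')) < e"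
proof -
  have "uniformly_continuous_on (A \<times> B) f"
    using assms compact_Times compact_uniformly_continuous by blast
  from uniformly_continuous_onE[OF this \<open>e > 0\<close>]
  obtain d where d: "d > 0" "\<And>p q. p \<in> A \<times> B \<Longrightarrow> q \<in> A \<times> B \<Longrightarrow> dist q p < d \<Longrightarrow> dist (f q) (f p) < e"
    by metis
  show ?thesis
    by (rule that[OF d(1)]) (rule d(2); auto simp: dist_Pair_Pair)+
qed

text \<open>Cauchy's inequality bounds the difference of the y-derivatives of the slices at
  \<open>x\<close> and \<open>x0\<close> by the difference of the slices themselves, which uniform
  continuity makes small. What remains is continuity in y of the one-variable derivative at
  \<open>x0\<close>.\<close>

lemma continuous_on_deriv_snd:
  fixes f :: "C2 \<Rightarrow> complex"
  assumes U: "open U" and f: "continuous_on U f"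
    and hol: "\<And>x y. (x, y) \<in> U \<Longrightarrow> (\<lambda>y. f (x, y)) field_differentiable (at y)"
  shows "continuous_on U (\<lambda>p. deriv (\<lambda>y. f (fst p, y)) (snd p))"
proof (subst continuous_on_eq_continuous_at[OF U], intro ballI)
  fix p assume p: "p \<in> U"
  define x0 y0 where "x0 = fst p" and "y0 = snd p"
  have p_eq: "p = (x0, y0)" by (simp add: x0_def y0_def)
  obtain r where r: "r > 0" "cball x0 r \<times> cball y0 r \<subseteq> U"
    using open_prod_contains_cballs[OF U] p p_eq by metis
  have slice: "(\<lambda>y. f (x, y)) holomorphic_on ball y0 r" if "x \<in> cball x0 r" for x
    unfolding holomorphic_on_def using r that hol ball_subset_cball
    by (blast intro: field_differentiable_at_within)
  have contf: "continuous_on (cball x0 r \<times> cball y0 r) f" using continuous_on_subset[OF f r(2)] .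
  have x0: "x0 \<in> cball x0 r" using r by simp
  show "isCont (\<lambda>p. deriv (\<lambda>y. f (fst p, y)) (snd p)) p"
    unfolding isCont_def p_eq fst_conv snd_conv
  proof (rule tendstoI)
    fix e :: real assume e: "e > 0"
    \<comment> \<open>Cauchy's inequality on circles of radius \<open>r / 2\<close> turns the bound
      \<open>e * r / 4\<close> into \<open>e / 2\<close>.\<close>
    obtain d where d: "d > 0" "\<And>x x' y. x \<in> cball x0 r \<Longrightarrow> x' \<in> cball x0 r \<Longrightarrow> y \<in> cball y0 r \<Longrightarrow>
        dist x x' < d \<Longrightarrow> dist (f (x, y)) (f (x', y)) < e * r / 4"
      by (rule uniformly_close_slices[OF contf, of "e * r / 4"]) (use e r in auto)
    have close: "norm (deriv (\<lambda>y. f (x, y)) y - deriv (\<lambda>y. f (x0, y)) y) \<le> e / 2"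
      if x: "dist x x0 < min d r" and y: "dist y y0 < r / 2" for x y
    proof -
      have xr: "x \<in> cball x0 r" using x by (simp add: dist_commute)
      have sub: "cball y (r / 2) \<subseteq> ball y0 r"
        using y by (intro cball_subset_ball_iff[THEN iffD2]) auto
      have sl: "(\<lambda>y. f (x, y)) holomorphic_on cball y (r/2)" "(\<lambda>y. f (x0, y)) holomorphic_on cball y (r/2)"
        using slice[OF xr] slice[OF x0] sub holomorphic_on_subset by blast+
      have "norm ((deriv ^^ 1) (\<lambda>y. f (x, y) - f (x0, y)) y) \<le> fact 1 * (e * r / 4) / (r / 2) ^ 1"
      proof (rule Cauchy_inequality)
        show "(\<lambda>y. f (x, y) - f (x0, y)) holomorphic_on ball y (r/2)"
          using sl ball_subset_cball by (intro holomorphic_intros) (blast intro: holomorphic_on_subset)+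
        show "continuous_on (cball y (r/2)) (\<lambda>y. f (x, y) - f (x0, y))"
          using sl by (intro continuous_intros holomorphic_on_imp_continuous_on)
        show "norm (f (x, z) - f (x0, z)) \<le> e * r / 4" if "norm (y - z) = r / 2" for z
        proof -
          have "z \<in> cball y (r/2)" using that by (simp add: dist_norm)
          then have "z \<in> cball y0 r" using sub by auto
          then show ?thesis using d(2)[OF xr x0] x by (auto simp: dist_norm less_imp_le)
        qed
      qed (use r in auto)
      moreover have "deriv (\<lambda>y. f (x, y) - f (x0, y)) y = deriv (\<lambda>y. f (x, y)) y - deriv (\<lambda>y. f (x0, y)) y"
      proof (rule deriv_diff)
        have "(x, y) \<in> U" "(x0, y) \<in> U" using r xr x0 y by (auto simp: subset_iff dist_commute)
        then show "(\<lambda>y. f (x, y)) field_differentiable at y" "(\<lambda>y. f (x0, y)) field_differentiable at y"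
          by (auto intro: hol)
      qed
      ultimately show ?thesis using r by simp
    qed
    have "isCont (deriv (\<lambda>y. f (x0, y))) y0"
      using holomorphic_on_imp_continuous_on[OF holomorphic_deriv[OF slice[OF x0] open_ball]] r
      by (simp add: continuous_on_eq_continuous_at)
    then have "((\<lambda>q. deriv (\<lambda>y. f (x0, y)) (snd q)) \<longlongrightarrow> deriv (\<lambda>y. f (x0, y)) y0) (at (x0, y0))"
      by (intro isCont_tendsto_compose[where g = "deriv (\<lambda>y. f (x0, y))"]) (auto intro!: tendsto_eq_intros)
    from tendstoD[OF this, of "e / 2"] e
    have "\<forall>\<^sub>F q in at (x0, y0). dist (deriv (\<lambda>y. f (x0, y)) (snd q)) (deriv (\<lambda>y. f (x0, y)) y0) < e / 2"
      by simp
    moreover have "\<forall>\<^sub>F q in at (x0, y0). q \<in> ball x0 (min d r) \<times> ball y0 (r / 2)"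
      using d r by (intro eventually_at_in_open') (auto intro: open_Times)
    ultimately show "\<forall>\<^sub>F q in at (x0, y0). dist (deriv (\<lambda>y. f (fst q, y)) (snd q)) (deriv (\<lambda>y. f (x0, y)) y0) < e"
    proof eventually_elim
      case (elim q)
      then have "norm (deriv (\<lambda>y. f (fst q, y)) (snd q) - deriv (\<lambda>y. f (x0, y)) (snd q)) \<le> e / 2"
        by (intro close) (auto simp: dist_commute mem_Times_iff)
      then show ?case using elim(1)
        by (smt (verit) dist_norm dist_triangle field_sum_of_halves)
    qed
  qed
qed

text \<open>Total differentiability needs an x-derivative at the point and a y-derivative that is
  jointly continuous, which is \<open>continuous_on_deriv_snd\<close>. Both partial derivatives
  being complex, the total derivative is complex linear.\<close>

lemma osgood:
  fixes f :: "C2 \<Rightarrow> complex"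
  assumes U: "open U" and f: "continuous_on U f"
    and hol1: "\<And>x y. (x, y) \<in> U \<Longrightarrow> (\<lambda>x. f (x, y)) field_differentiable (at x)"
    and hol2: "\<And>x y. (x, y) \<in> U \<Longrightarrow> (\<lambda>y. f (x, y)) field_differentiable (at y)"
  shows "holo_on f U"
  unfolding holo_on_def
proof (intro conjI ballI U)
  fix p assume p: "p \<in> U"
  define x0 y0 where "x0 = fst p" and "y0 = snd p"
  have p_eq: "p = (x0, y0)" by (simp add: x0_def y0_def)
  obtain r where r: "r > 0" "cball x0 r \<times> cball y0 r \<subseteq> U"
    using open_prod_contains_cballs[OF U] p p_eq by metis
  let ?X = "ball x0 r" and ?Y = "ball y0 r"
  have XY: "?X \<times> ?Y \<subseteq> U" using r(2) by auto
  have op: "open (?X \<times> ?Y)" by (intro open_Times open_ball)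
  obtain a where a: "((\<lambda>x. f (x, y0)) has_field_derivative a) (at x0)"
    using hol1 p p_eq by (auto simp: field_differentiable_def)
  have "((\<lambda>(x, y). f (x, y)) has_derivative
      (\<lambda>(u, v). a * u + blinfun_mult_right (deriv (\<lambda>y. f (x0, y)) y0) v)) (at (x0, y0) within ?X \<times> ?Y)"
  proof (rule has_derivative_partialsI)
    show "((\<lambda>x. f (x, y0)) has_derivative (*) a) (at x0 within ?X)"
      using a by (auto simp: has_field_derivative_def intro: has_derivative_at_withinI)
    show "((\<lambda>y. f (x, y)) has_derivative blinfun_mult_right (deriv (\<lambda>y. f (x, y)) y)) (at y within ?Y)"
      if "x \<in> ?X" "y \<in> ?Y" for x y
      using hol2[of x y] XY that
      by (auto simp: DERIV_deriv_iff_field_differentiable[symmetric] has_field_derivative_def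
            subset_iff blinfun_mult_right.rep_eq intro: has_derivative_at_withinI)
    \<comment> \<open>The y-derivative has to be continuous as a linear map;
      \<open>blinfun_mult_right\<close> depends linearly and boundedly on its factor, so continuity
      of the scalar derivative is enough.\<close>
    have "isCont (\<lambda>p. deriv (\<lambda>y. f (fst p, y)) (snd p)) (x0, y0)"
      using continuous_on_deriv_snd[OF U f hol2] p p_eq U by (auto simp: continuous_on_eq_continuous_at)
    then have "isCont (\<lambda>p. blinfun_mult_right (deriv (\<lambda>y. f (fst p, y)) (snd p))) (x0, y0)"
      by (rule bounded_linear.isCont[OF bounded_linear_blinfun_mult_right])
    then show "continuous (at (x0, y0) within ?X \<times> ?Y) (\<lambda>(x, y). blinfun_mult_right (deriv (\<lambda>y. f (x, y)) y))"
      by - (rule continuous_at_imp_continuous_at_within, simp add: case_prod_unfold)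
  qed (use r in auto)
  then have "(f has_derivative (\<lambda>(u, v). a * u + deriv (\<lambda>y. f (x0, y)) y0 * v)) (at p)"
    using r by (simp add: at_within_open[OF _ op] p_eq blinfun_mult_right.rep_eq)
  then show "\<exists>a b. (f has_derivative (\<lambda>(u, v). a * u + b * v)) (at p)" by blast
qed

section \<open>Division by a coordinate\<close>

lemma holo_on_slice1:
  assumes "holo_on f U"
  shows "(\<lambda>x. f (x, y)) holomorphic_on {x. (x, y) \<in> U}" "open {x. (x, y) \<in> U}"
proof -
  have "open ((\<lambda>x. (x, y)) -` U)"
    using assms by (intro open_vimage continuous_intros) (auto simp: holo_on_def)
  then show "open {x. (x, y) \<in> U}" by (simp add: vimage_def)
  then show "(\<lambda>x. f (x, y)) holomorphic_on {x. (x, y) \<in> U}"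
    by (intro holo_on_curve[OF assms] holomorphic_intros) auto
qed

lemma holo_on_slice2:
  assumes "holo_on f U"
  shows "(\<lambda>y. f (x, y)) holomorphic_on {y. (x, y) \<in> U}" "open {y. (x, y) \<in> U}"
proof -
  have "open ((\<lambda>y. (x, y)) -` U)"
    using assms by (intro open_vimage continuous_intros) (auto simp: holo_on_def)
  then show "open {y. (x, y) \<in> U}" by (simp add: vimage_def)
  then show "(\<lambda>y. f (x, y)) holomorphic_on {y. (x, y) \<in> U}"
    by (intro holo_on_curve[OF assms] holomorphic_intros) auto
qed

text \<open>On the axis the quotient takes its removable value, the x-derivative of
  \<open>f\<close>. It is then holomorphic in x by removal of the singularity, jointly continuous by
  the maximum principle, and holomorphic in y as a limit of slices off the axis, so
  \<open>osgood\<close> applies.\<close>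

lemma holo_on_divide_fst:
  assumes f: "holo_on f U" and zero: "\<And>y. (0, y) \<in> U \<Longrightarrow> f (0, y) = 0"
  obtains k where "holo_on k U" "\<And>p. p \<in> U \<Longrightarrow> f p = fst p * k p"
proof
  define k where "k p = (if fst p = 0 then deriv (\<lambda>x. f (x, snd p)) 0 else f p / fst p)" for p
  have U: "open U" using f by (simp add: holo_on_def)
  note contf = holo_on_imp_continuous_on[OF f]
  show "f p = fst p * k p" if "p \<in> U" for p
    using zero[of "snd p"] that by (cases p) (auto simp: k_def)
  have slice1: "(\<lambda>x. k (x, y)) holomorphic_on {x. (x, y) \<in> U}" for y
  proof (cases "(0, y) \<in> U")
    case True
    have "k (x, y) = (if x = 0 then deriv (\<lambda>x. f (x, y)) 0 else (f (x, y) - f (0, y)) / (x - 0))" for x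
      using zero[OF True] by (simp add: k_def)
    then show ?thesis using pole_lemma_open[OF holo_on_slice1[OF f, of y], of 0] by simp
  next
    \<comment> \<open>Here the slice does not meet x = 0, and the plain quotient is holomorphic on
      it.\<close>
    case False
    have "(\<lambda>x. f (x, y) / x) holomorphic_on {x. (x, y) \<in> U}"
      using False by (intro holomorphic_intros holo_on_slice1[OF f]) auto
    then show ?thesis
      by (rule holomorphic_transform) (use False in \<open>auto simp: k_def\<close>)
  qed
  have slice2_nz: "(\<lambda>y. k (x, y)) holomorphic_on {y. (x, y) \<in> U}" if "x \<noteq> 0" for x
  proof -
    have "(\<lambda>y. f (x, y) / x) holomorphic_on {y. (x, y) \<in> U}"
      using that by (intro holomorphic_intros holo_on_slice2[OF f]) auto
    then show ?thesis using that by (simp add: k_def)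
  qed
  have contk: "continuous_on U k"
  proof (subst continuous_on_eq_continuous_at[OF U], intro ballI)
    fix p assume p: "p \<in> U"
    show "isCont k p"
    proof (cases "fst p = 0")
      case False
      have "\<forall>\<^sub>F q in nhds p. fst q \<noteq> 0"
        using False tendsto_imp_eventually_ne[OF tendsto_fst[OF filterlim_ident]] by blast
      then have "\<forall>\<^sub>F q in nhds p. k q = f q / fst q" by eventually_elim (simp add: k_def)
      moreover have "isCont f p"
        using contf p U by (simp add: continuous_on_eq_continuous_at)
      ultimately show ?thesis
        unfolding isCont_cong[OF \<open>\<forall>\<^sub>F q in nhds p. k q = f q / fst q\<close>]
        using False by (intro continuous_divide continuous_fst continuous_ident) auto
    next
      case True
      define y0 where "y0 = snd p"
      have p_eq: "p = (0, y0)" using True by (simp add: y0_def prod_eq_iff)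
      obtain r where r: "r > 0" "cball 0 r \<times> cball y0 r \<subseteq> U"
        using open_prod_contains_cballs[OF U] p p_eq by metis
      have contf': "continuous_on (cball 0 r \<times> cball y0 r) f" using continuous_on_subset[OF contf r(2)] .
      have y0: "y0 \<in> cball y0 r" using r by simp
      show ?thesis unfolding isCont_def p_eq
      proof (rule tendstoI)
        fix e :: real assume e: "e > 0"
        \<comment> \<open>If \<open>norm x < r / 4\<close>, points of the circle of radius
          \<open>r / 2\<close> about \<open>x\<close> have norm at least \<open>r / 4\<close>, so
          dividing by them leaves \<open>e / 2\<close>. Cauchy's inequality of order 0 acts as the
          maximum principle and carries this bound to the centre.\<close>
        obtain d where d: "d > 0" "\<And>x y y'. x \<in> cball 0 r \<Longrightarrow> y \<in> cball y0 r \<Longrightarrow> y' \<in> cball y0 r \<Longrightarrow>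
            dist y y' < d \<Longrightarrow> dist (f (x, y)) (f (x, y')) < e / 2 * (r / 4)"
          by (rule uniformly_close_slices[OF contf', of "e / 2 * (r / 4)"]) (use e r in auto)
        have close: "norm (k (x, y) - k (x, y0)) \<le> e / 2"
          if x: "norm x < r / 4" and y: "dist y y0 < min d r" for x y
        proof -
          have yr: "y \<in> cball y0 r" using y by (simp add: dist_commute)
          have sub: "cball x (r / 2) \<subseteq> cball 0 r"
            using x by (intro cball_subset_cball_iff[THEN iffD2]) auto
          have sl: "(\<lambda>x. k (x, y)) holomorphic_on cball x (r/2)" if "y \<in> cball y0 r" for y
            using sub r that by (intro holomorphic_on_subset[OF slice1]) auto
          \<comment> \<open>\<open>k\<close> is estimated through its values on a circle that avoids the line \<open>x = 0\<close>\<close>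
          have "norm ((deriv ^^ 0) (\<lambda>x. k (x, y) - k (x, y0)) x) \<le> fact 0 * (e / 2) / (r / 2) ^ 0"
          proof (rule Cauchy_inequality)
            show "(\<lambda>x. k (x, y) - k (x, y0)) holomorphic_on ball x (r/2)"
              using sl[OF yr] sl[OF y0] ball_subset_cball
              by (intro holomorphic_intros) (blast intro: holomorphic_on_subset)+
            show "continuous_on (cball x (r/2)) (\<lambda>x. k (x, y) - k (x, y0))"
              using sl[OF yr] sl[OF y0] by (intro continuous_intros holomorphic_on_imp_continuous_on)
            show "norm (k (z, y) - k (z, y0)) \<le> e / 2" if z: "norm (x - z) = r / 2" for z
            proof -
              have "z \<in> cball x (r/2)" using that by (simp add: dist_norm)
              then have zr: "z \<in> cball 0 r" using sub by auto
              have zn: "norm z \<ge> r / 4"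
                using z x norm_triangle_ineq4[of x z] by simp
              then have "z \<noteq> 0" using r by auto
              then have "k (z, y) - k (z, y0) = (f (z, y) - f (z, y0)) / z"
                by (simp add: k_def diff_divide_distrib)
              moreover have "norm (f (z, y) - f (z, y0)) \<le> e / 2 * (r / 4)"
                using d(2)[OF zr yr y0] y by (simp add: dist_norm)
              moreover have "e / 2 * (r / 4) \<le> e / 2 * norm z"
                using zn e by (intro mult_left_mono) auto
              ultimately show ?thesis using \<open>z \<noteq> 0\<close> by (simp add: norm_divide divide_le_eq)
            qed
          qed (use r in auto)
          then show ?thesis by simp
        qed
        have "isCont (\<lambda>x. k (x, y0)) 0"
          using holomorphic_on_imp_continuous_on[OF slice1[of y0]] holo_on_slice1(2)[OF f] p p_eq
          by (auto simp: continuous_on_eq_continuous_at)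
        then have "((\<lambda>q. k (fst q, y0)) \<longlongrightarrow> k (0, y0)) (at (0, y0))"
          by (intro isCont_tendsto_compose[where g = "\<lambda>x. k (x, y0)"]) (auto intro!: tendsto_eq_intros)
        from tendstoD[OF this, of "e / 2"] e
        have "\<forall>\<^sub>F q in at (0, y0). dist (k (fst q, y0)) (k (0, y0)) < e / 2"
          by simp
        moreover have "\<forall>\<^sub>F q in at (0, y0). q \<in> ball 0 (r / 4) \<times> ball y0 (min d r)"
          using d r by (intro eventually_at_in_open') (auto intro: open_Times)
        ultimately show "\<forall>\<^sub>F q in at (0, y0). dist (k q) (k (0, y0)) < e"
        proof eventually_elim
          case (elim q)
          then have "norm (k (fst q, snd q) - k (fst q, y0)) \<le> e / 2"
            by (intro close) (auto simp: dist_commute mem_Times_iff)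
          then show ?case using elim(1)
            by (smt (verit) dist_norm dist_triangle field_sum_of_halves prod.collapse)
        qed
      qed
    qed
  qed
  show "holo_on k U"
  proof (rule osgood[OF U contk])
    fix x y assume xy: "(x, y) \<in> U"
    show "(\<lambda>x. k (x, y)) field_differentiable at x"
      using slice1 holo_on_slice1(2)[OF f] xy by (auto intro: holomorphic_on_imp_differentiable_at)
    show "(\<lambda>y. k (x, y)) field_differentiable at y"
    proof (cases "x = 0")
      case False
      then show ?thesis
        using slice2_nz holo_on_slice2(2)[OF f] xy by (auto intro: holomorphic_on_imp_differentiable_at)
    next
      case True
      obtain r where r: "r > 0" "cball 0 r \<times> cball y r \<subseteq> U"
        using open_prod_contains_cballs[OF U] xy True by metis
      have contk': "continuous_on (cball 0 r \<times> cball y r) k" using continuous_on_subset[OF contk r(2)] .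
      \<comment> \<open>By the joint continuity of \<open>k\<close>, its slice on the axis is a
        uniform limit of slices at the points \<open>s n\<close> off the axis. \<open>Suc n\<close>
        avoids a division by 0 and keeps \<open>s n\<close> within radius \<open>r\<close>.\<close>
      define s where "s n = complex_of_real (r / real (Suc n))" for n
      have s_norm: "norm (s n) = r / real (Suc n)" for n
        using r unfolding s_def norm_of_real by simp
      have s_r: "s n \<noteq> 0" "s n \<in> cball 0 r" for n
      proof -
        have "r / real (Suc n) > 0" using r by simp
        then show "s n \<noteq> 0" unfolding s_norm[symmetric] by simp
        show "s n \<in> cball 0 r" using r by (simp add: s_norm divide_le_eq)
      qed
      have "(\<lambda>n. r / real (Suc n)) \<longlonglongrightarrow> 0" by (rule LIMSEQ_Suc[OF lim_const_over_n])
      then have s_lim: "s \<longlonglongrightarrow> 0" by (rule Lim_null_comparison[rotated]) (simp add: s_norm)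
      have lim: "uniform_limit (cball y r) (\<lambda>n y. k (s n, y)) (\<lambda>y. k (0, y)) sequentially"
      proof (rule uniform_limitI)
        fix e :: real assume "e > 0"
        from uniformly_close_slices[OF contk' compact_cball compact_cball this]
        obtain d where d: "d > 0" "\<And>x x' z. x \<in> cball 0 r \<Longrightarrow> x' \<in> cball 0 r \<Longrightarrow> z \<in> cball y r \<Longrightarrow>
            dist x x' < d \<Longrightarrow> dist (k (x, z)) (k (x', z)) < e" by metis
        from tendstoD[OF s_lim d(1)]
        show "\<forall>\<^sub>F n in sequentially. \<forall>z\<in>cball y r. dist (k (s n, z)) (k (0, z)) < e"
        proof eventually_elim
          case (elim n)
          then show ?case using d(2)[OF s_r(2)] r by auto
        qed
      qed
      have hol_s: "(\<lambda>y. k (s n, y)) holomorphic_on ball y r" for n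
      proof (rule holomorphic_on_subset[OF slice2_nz[OF s_r(1)]], rule subsetI)
        fix z assume "z \<in> ball y r"
        then have "(s n, z) \<in> cball 0 r \<times> cball y r" using s_r(2) by simp
        then show "z \<in> {y. (s n, y) \<in> U}" using r(2) by blast
      qed
      have lim_ball: "uniform_limit (ball y r) (\<lambda>n y. k (s n, y)) (\<lambda>y. k (0, y)) sequentially"
        by (rule uniform_limit_on_subset[OF lim ball_subset_cball])
      have "\<exists>d>0. cball z d \<subseteq> ball y r \<and>
          uniform_limit (cball z d) (\<lambda>n y. k (s n, y)) (\<lambda>y. k (0, y)) sequentially" if z: "z \<in> ball y r" for z
      proof -
        obtain d where d: "d > 0" "cball z d \<subseteq> ball y r"
          using open_contains_cball_eq[OF open_ball] z by metis
        show ?thesis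
          using d uniform_limit_on_subset[OF lim_ball d(2)] by (intro exI[of _ d]) simp
      qed
      with hol_s have "(\<lambda>y. k (0, y)) holomorphic_on ball y r"
        by (rule holomorphic_uniform_sequence[where f = "\<lambda>n y. k (s n, y)", OF open_ball])
      from holomorphic_on_imp_differentiable_at[OF this open_ball, of y] show ?thesis
        using r True by simp
    qed
  qed
qed

lemma holo_on_divide_snd:
  assumes f: "holo_on f U" and zero: "\<And>x. (x, 0) \<in> U \<Longrightarrow> f (x, 0) = 0"
  obtains k where "holo_on k U" "\<And>p. p \<in> U \<Longrightarrow> f p = snd p * k p"
proof -
  obtain k where k: "holo_on k (prod.swap -` U)"
    "\<And>p. p \<in> prod.swap -` U \<Longrightarrow> f (prod.swap p) = fst p * k p"
    by (rule holo_on_divide_fst[OF holo_on_swap[OF f]]) (use zero in auto)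
  show ?thesis
  proof (rule that[of "\<lambda>p. k (prod.swap p)"])
    show "holo_on (\<lambda>p. k (prod.swap p)) U"
      using holo_on_swap[OF k(1)] by (simp add: vimage_def)
    show "f p = snd p * k (prod.swap p)" if "p \<in> U" for p
      using k(2)[of "prod.swap p"] that by simp
  qed
qed

text \<open>The division lemmas do not tell the value of \<open>k\<close> at the origin. It is read
  off along a curve through 0, where \<open>s * k (x s, y s)\<close> has derivative
  \<open>k 0\<close> at s = 0.\<close>

lemma quotient_at_0:
  assumes k: "holo_on k W" "0 \<in> W"
    and x: "(x has_field_derivative x') (at 0)" "x 0 = 0"
    and y: "(y has_field_derivative y') (at 0)" "y 0 = 0"
    and F: "(F has_field_derivative l) (at 0)"
    and ev: "\<forall>\<^sub>F s in nhds 0. F s = s * k (x s, y s)"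
  shows "k 0 = l"
proof -
  obtain a b where "(k has_derivative (\<lambda>(u, v). a * u + b * v)) (at 0)" by (rule holo_onD[OF k])
  then have "((\<lambda>s. k (x s, y s)) has_field_derivative a * x' + b * y') (at 0)"
    using x y by (intro has_field_derivative_curve) (auto simp: zero_prod_def)
  then have "((\<lambda>s. s * k (x s, y s)) has_field_derivative k 0) (at 0)"
    using x y by (auto intro!: derivative_eq_intros simp: zero_prod_def)
  moreover have "((\<lambda>s. s * k (x s, y s)) has_field_derivative l) (at 0)"
    using F by (subst DERIV_cong_ev[OF refl ev refl, symmetric])
  ultimately show ?thesis by (rule DERIV_unique)
qed

section \<open>Invariant curves\<close>

text \<open>This is the form in which the order enters the estimate of \<open>F\<close>: with
  \<open>y = x * w\<close> and bounded \<open>w\<close>, \<open>\<phi>\<close> is negligible against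
  x.\<close>

lemma order_ge_2_bound:
  assumes "order_ge_2 \<phi>" "e > 0"
  shows "\<forall>\<^sub>F p in nhds 0. norm (\<phi> p) \<le> e * norm p"
proof -
  have "\<phi> 0 = 0" "(\<phi> has_derivative (\<lambda>_. 0)) (at 0)" using assms by (auto simp: order_ge_2_def)
  then obtain d where "d > 0" "\<And>p. norm p < d \<Longrightarrow> norm (\<phi> p) \<le> e * norm p"
    using assms(2) unfolding has_derivative_at_alt by fastforce
  then show ?thesis by (auto simp: eventually_nhds_metric)
qed

text \<open>The last conclusion is tangency of the field to the graph of \<open>g\<close>.
  \<open>F\<close> is bounded by 1/2 for \<open>norm w < 3\<close>, and Cauchy's inequality on unit
  discs makes it a contraction with factor 1/2 on the closed unit disc, as
  \<open>briot_bouquet\<close> requires.\<close>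

lemma invariant_graph:
  assumes U: "open U" "0 \<in> U"
    and \<phi>: "holo_on \<phi>1 U" "holo_on \<phi>2 U" "order_ge_2 \<phi>1" "order_ge_2 \<phi>2"
    and l: "l1 \<noteq> 0" and neg: "l2 / l1 \<in> complex_of_real ` {..<0}"
  obtains r g where "r > 0" "g holomorphic_on ball 0 r" "g 0 = 0" "deriv g 0 = 0"
    "\<And>x. x \<in> ball 0 r \<Longrightarrow> (x, g x) \<in> U"
    "\<And>x. x \<in> ball 0 r \<Longrightarrow>
       l2 * g x + \<phi>2 (x, g x) = deriv g x * (l1 * x + \<phi>1 (x, g x))"
proof -
  obtain \<mu> where \<mu>: "l2 / l1 = complex_of_real \<mu>" "\<mu> < 0" using neg by auto
  \<comment> \<open>Substituting \<open>y = x * w\<close> turns the equation of the invariant curve into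
    \<open>x * w' = (l2 / l1 - 1) * w + F x w\<close>, and \<open>F x w\<close> is small near \<open>x = 0\<close> because \<open>\<phi>1\<close>, \<open>\<phi>2\<close>
    have order at least 2.\<close>
  define F where "F x w = (if x = 0 then 0 else
      (l2 * (x * w) + \<phi>2 (x, x * w)) / (l1 * x + \<phi>1 (x, x * w)) - l2 / l1 * w)" for x w
  have F0: "F 0 w = 0" for w by (simp add: F_def)
  \<comment> \<open>The disc of radius 3 contains the closed unit disc about every point of the
    closed unit disc, where Cauchy's inequality will be used.\<close>
  have small: "\<exists>d>0. \<forall>x w. norm x < d \<longrightarrow> norm w < 3 \<longrightarrow>
      (x, x * w) \<in> U \<and> (x \<noteq> 0 \<longrightarrow> l1 * x + \<phi>1 (x, x * w) \<noteq> 0) \<and> norm (F x w) \<le> e"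
    if "e > 0" for e
  proof -
    \<comment> \<open>\<open>K * norm x\<close> will bound \<open>norm (l1 * D)\<close> from below.
      The first entry of \<open>\<epsilon>\<close> keeps \<open>\<phi>1\<close> at most half the
      linear part of the denominator; the second makes the numerator at most
      \<open>e * K * norm x\<close>. The factor 4 comes from
      \<open>norm (x, x * w) \<le> 4 * norm x\<close>, the 3 from \<open>norm w < 3\<close>.\<close>
    define K where "K = norm l1 * norm l1 / 2"
    have K: "K > 0" using l by (simp add: K_def)
    define \<epsilon> where "\<epsilon> = min (norm l1 / 8) (e * K / (4 * (norm l1 + 3 * norm l2)))"
    have L: "norm l1 + 3 * norm l2 > 0" using l by (simp add: add_pos_nonneg)
    have \<epsilon>: "\<epsilon> > 0" "4 * \<epsilon> \<le> norm l1 / 2"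
      using that K l L by (auto simp: \<epsilon>_def)
    have "\<epsilon> * (4 * (norm l1 + 3 * norm l2)) \<le> e * K"
      using L by (subst pos_le_divide_eq[symmetric]) (auto simp: \<epsilon>_def)
    then have \<epsilon>K: "4 * \<epsilon> * (norm l1 + 3 * norm l2) \<le> e * K" by (simp add: algebra_simps)
    have "\<forall>\<^sub>F p in nhds 0. p \<in> U \<and> norm (\<phi>1 p) \<le> \<epsilon> * norm p \<and> norm (\<phi>2 p) \<le> \<epsilon> * norm p"
      by (intro eventually_conj order_ge_2_bound \<phi> \<epsilon> eventually_nhds_in_open U)
    then obtain d where d: "d > 0" "\<And>p. norm p < d \<Longrightarrow>
        p \<in> U \<and> norm (\<phi>1 p) \<le> \<epsilon> * norm p \<and> norm (\<phi>2 p) \<le> \<epsilon> * norm p"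
      by (auto simp: eventually_nhds_metric)
    show ?thesis
    proof (intro exI[of _ "d / 4"] conjI allI impI)
      show "d / 4 > 0" using d by simp
      fix x w :: complex assume x: "norm x < d / 4" and w: "norm w < 3"
      have "norm (x, x * w) \<le> norm x + norm (x * w)" by (rule norm_Pair_le)
      also have "\<dots> \<le> norm x + norm x * 3"
        unfolding norm_mult using w by (intro add_left_mono mult_left_mono) auto
      finally have p: "norm (x, x * w) \<le> 4 * norm x" by simp
      then have "norm (x, x * w) < d" using x by simp
      note dp = d(2)[OF this]
      show "(x, x * w) \<in> U" using dp by blast
      have "\<epsilon> * norm (x, x * w) \<le> 4 * \<epsilon> * norm x"
        using p \<epsilon> by (simp add: mult.assoc mult_left_mono)
      then have b1: "norm (\<phi>1 (x, x * w)) \<le> 4 * \<epsilon> * norm x" and b2: "norm (\<phi>2 (x, x * w)) \<le> 4 * \<epsilon> * norm x"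
        using dp by linarith+
      have den: "norm (l1 * x + \<phi>1 (x, x * w)) \<ge> norm l1 / 2 * norm x"
      proof -
        have "norm (\<phi>1 (x, x * w)) \<le> norm l1 / 2 * norm x"
          using b1 \<epsilon>(2) by (meson mult_right_mono norm_ge_zero order_trans)
        then show ?thesis
          using norm_diff_ineq[of "l1 * x" "\<phi>1 (x, x * w)"] by (simp add: norm_mult)
      qed
      show nz: "l1 * x + \<phi>1 (x, x * w) \<noteq> 0" if "x \<noteq> 0"
      proof -
        have "norm l1 / 2 * norm x > 0" using that l by simp
        with den show ?thesis by (metis norm_zero not_le)
      qed
      show "norm (F x w) \<le> e"
      proof (cases "x = 0")
        case True then show ?thesis using that by (simp add: F0)
      next
        case False
        \<comment> \<open>Over the common denominator \<open>l1 * D\<close> the terms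
          \<open>l1 * l2 * x * w\<close> cancel; every term left in \<open>N\<close> has a factor
          \<open>\<phi>1\<close> or \<open>\<phi>2\<close>, which is why \<open>F\<close> is
          small.\<close>
        define D where "D = l1 * x + \<phi>1 (x, x * w)"
        define N where "N = l1 * \<phi>2 (x, x * w) - l2 * w * \<phi>1 (x, x * w)"
        have "D \<noteq> 0" using nz[OF False] by (simp add: D_def)
        have "F x w = N / (l1 * D)"
        proof -
          have "F x w = (l2 * (x * w) + \<phi>2 (x, x * w)) / D - l2 / l1 * w"
            using False by (simp add: F_def D_def)
          also have "\<dots> = ((l2 * (x * w) + \<phi>2 (x, x * w)) * l1 - l2 * w * D) / (l1 * D)"
            using \<open>D \<noteq> 0\<close> l by (simp add: divide_simps)
          finally show ?thesis by (simp add: N_def D_def algebra_simps)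
        qed
        moreover have "norm N \<le> e * norm (l1 * D)"
        proof -
          have "norm N \<le> norm l1 * norm (\<phi>2 (x, x * w)) + norm l2 * norm w * norm (\<phi>1 (x, x * w))"
            unfolding N_def by (rule order_trans[OF norm_triangle_ineq4]) (simp add: norm_mult)
          also have "\<dots> \<le> norm l1 * (4 * \<epsilon> * norm x) + norm l2 * 3 * (4 * \<epsilon> * norm x)"
            using w b1 b2 by (intro add_mono mult_mono) auto
          also have "\<dots> = 4 * \<epsilon> * (norm l1 + 3 * norm l2) * norm x" by (simp add: algebra_simps)
          also have "\<dots> \<le> e * K * norm x" using \<epsilon>K by (intro mult_right_mono) auto
          also have "\<dots> = e * (norm l1 * (norm l1 / 2 * norm x))" by (simp add: K_def)
          also have "\<dots> \<le> e * (norm l1 * norm D)"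
            using den that by (intro mult_left_mono) (auto simp: D_def)
          finally show ?thesis by (simp add: norm_mult)
        qed
        ultimately show ?thesis
          using \<open>D \<noteq> 0\<close> l by (simp add: norm_divide divide_le_eq)
      qed
    qed
  qed
  obtain r where r: "r > 0"
    and rU: "\<And>x w. x \<in> ball 0 r \<Longrightarrow> norm w < 3 \<Longrightarrow> (x, x * w) \<in> U"
    and rnz: "\<And>x w. x \<in> ball 0 r \<Longrightarrow> norm w < 3 \<Longrightarrow> x \<noteq> 0 \<Longrightarrow> l1 * x + \<phi>1 (x, x * w) \<noteq> 0"
    and rF: "\<And>x w. x \<in> ball 0 r \<Longrightarrow> norm w < 3 \<Longrightarrow> norm (F x w) \<le> 1 / 2"
    using small[of "1/2"] by auto
  have Fw_hol: "F x holomorphic_on ball 0 3" if x: "x \<in> ball 0 r" for x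
  proof (cases "x = 0")
    case True then show ?thesis by (simp add: F0[abs_def] cong: holomorphic_cong)
  next
    case False
    have "(\<lambda>w. \<phi>1 (x, x * w)) holomorphic_on ball 0 3" "(\<lambda>w. \<phi>2 (x, x * w)) holomorphic_on ball 0 3"
      using rU[OF x] by (intro holo_on_curve[OF \<phi>(1)] holo_on_curve[OF \<phi>(2)] holomorphic_intros; simp)+
    then have "(\<lambda>w. (l2 * (x * w) + \<phi>2 (x, x * w)) / (l1 * x + \<phi>1 (x, x * w)) - l2 / l1 * w) holomorphic_on ball 0 3"
      using rnz[OF x _ False] l by (intro holomorphic_intros) auto
    then show ?thesis using False by (simp add: F_def[abs_def])
  qed
  obtain w where w: "w holomorphic_on ball 0 r" "\<And>x. x \<in> ball 0 r \<Longrightarrow> norm (w x) \<le> 1"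
    and weq: "\<And>x. x \<in> ball 0 r \<Longrightarrow> x * deriv w x = F x (w x) - of_real (1 - \<mu>) * w x"
  proof (rule briot_bouquet[of "1 - \<mu>" r F])
    show "1 - \<mu> > 1" using \<mu> by simp
    show "norm (F x w) \<le> 1" if "x \<in> ball 0 r" "norm w \<le> 1" for x w
      using rF[of x w] that by simp
    show "norm (F x v - F x w) \<le> norm (v - w) / 2"
      if x: "x \<in> ball 0 r" and vw: "norm v \<le> 1" "norm w \<le> 1" for x v w
    proof -
      have "norm (F x v - F x w) \<le> 1/2 * norm (v - w)"
      proof (rule field_differentiable_bound[OF convex_cball])
        fix z :: complex assume z: "z \<in> cball 0 1"
        show "(F x has_field_derivative deriv (F x) z) (at z within cball 0 1)"
          using holomorphic_derivI[OF Fw_hol[OF x] open_ball, of z] z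
          by (auto intro: has_field_derivative_at_within)
        have sub: "cball z 1 \<subseteq> ball 0 3"
          using z by (auto simp: dist_norm) (smt (verit, best) norm_minus_commute norm_triangle_sub)
        have "norm ((deriv ^^ 1) (F x) z) \<le> fact 1 * (1 / 2) / 1 ^ 1"
        proof (rule Cauchy_inequality)
          show "F x holomorphic_on ball z 1"
            using sub ball_subset_cball by (intro holomorphic_on_subset[OF Fw_hol[OF x]]) blast
          show "continuous_on (cball z 1) (F x)"
            using sub by (intro continuous_on_subset[OF holomorphic_on_imp_continuous_on[OF Fw_hol[OF x]]])
          show "norm (F x y) \<le> 1 / 2" if "norm (z - y) = 1" for y
            using sub that rF[OF x, of y] by (auto simp: dist_norm subset_iff)
        qed auto
        then show "norm (deriv (F x) z) \<le> 1/2" by simp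
      qed (use vw in auto)
      then show ?thesis by simp
    qed
    \<comment> \<open>At x = 0 the quotient in \<open>F\<close> is 0 / 0. The value 0 assigned there
      is the limit, by \<open>small\<close>, so the singularity is removable.\<close>
    show "(\<lambda>x. F x (w x)) holomorphic_on ball 0 r"
      if w: "w holomorphic_on ball 0 r" "\<And>x. x \<in> ball 0 r \<Longrightarrow> norm (w x) \<le> 1" for w
    proof (rule no_isolated_singularity'[where K = "{0}"])
      have w3: "norm (w x) < 3" if "x \<in> ball 0 r" for x using w(2)[OF that] by simp
      have w': "w holomorphic_on ball 0 r - {0}" using w by (auto intro: holomorphic_on_subset)
      have "(\<lambda>x. \<phi>1 (x, x * w x)) holomorphic_on ball 0 r - {0}"
           "(\<lambda>x. \<phi>2 (x, x * w x)) holomorphic_on ball 0 r - {0}"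
        using rU w3 
        by (intro holo_on_curve[OF \<phi>(1)] holo_on_curve[OF \<phi>(2)] holomorphic_intros w' open_delete open_ball; simp)+
      then have "(\<lambda>x. (l2 * (x * w x) + \<phi>2 (x, x * w x)) / (l1 * x + \<phi>1 (x, x * w x)) - l2 / l1 * w x)
          holomorphic_on ball 0 r - {0}"
        using rnz w3 l by (intro holomorphic_intros w') auto
      then show "(\<lambda>x. F x (w x)) holomorphic_on ball 0 r - {0}"
        by (rule holomorphic_transform) (simp add: F_def)
      have "((\<lambda>x. F x (w x)) \<longlongrightarrow> 0) (at 0)"
      proof (rule tendstoI)
        fix e :: real assume e: "e > 0"
        obtain d where d: "d > 0" "\<And>x w. norm x < d \<Longrightarrow> norm w < 3 \<Longrightarrow> norm (F x w) \<le> e / 2"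
          using small[of "e/2"] e by auto
        have "\<forall>\<^sub>F x in at 0. x \<in> ball 0 (min d r)"
          using d r by (intro eventually_at_in_open') auto
        then show "\<forall>\<^sub>F x in at 0. dist (F x (w x)) 0 < e"
        proof eventually_elim
          case (elim x)
          then show ?case using d(2)[of x "w x"] w3[of x] e by auto
        qed
      qed
      then show "((\<lambda>x. F x (w x)) \<longlongrightarrow> F z (w z)) (at z within ball 0 r)" if "z \<in> {0}" for z
        using that r by (simp add: F0 at_within_open[OF _ open_ball])
    qed auto
  qed auto
  \<comment> \<open>At x = 0 the equation reduces to \<open>(1 - \<mu>) * w 0 = 0\<close>; the
    resulting \<open>w 0 = 0\<close> is what gives \<open>deriv g 0 = 0\<close>.\<close>
  have "0 \<in> ball 0 r" using r by simp
  from weq[OF this] have "of_real (1 - \<mu>) * w 0 = 0" by (simp only: F0) simp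
  then have w0: "w 0 = 0" using \<mu> by (simp only: mult_eq_0_iff of_real_eq_0_iff) simp
  define g where "g x = x * w x" for x
  have w3: "norm (w x) < 3" if "x \<in> ball 0 r" for x using w(2)[OF that] by simp
  have dg: "(g has_field_derivative w x + x * deriv w x) (at x)" if "x \<in> ball 0 r" for x
    unfolding g_def using holomorphic_derivI[OF w(1) open_ball that]
    by (auto intro!: derivative_eq_intros)
  note deriv_g = DERIV_imp_deriv[OF dg]
  show ?thesis
  proof (rule that[OF r, of g])
    show "g holomorphic_on ball 0 r" unfolding g_def by (intro holomorphic_intros w)
    show "g 0 = 0" by (simp add: g_def)
    show "deriv g 0 = 0" using deriv_g[of 0] w0 r by simp
    fix x :: complex assume x: "x \<in> ball 0 r"
    show "(x, g x) \<in> U" using rU[OF x w3[OF x]] by (simp add: g_def)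
    show "l2 * g x + \<phi>2 (x, g x) = deriv g x * (l1 * x + \<phi>1 (x, g x))"
    proof (cases "x = 0")
      case True
      then show ?thesis using \<phi> by (simp add: g_def order_ge_2_def zero_prod_def)
    next
      case False
      \<comment> \<open>\<open>1 - (1 - \<mu>)\<close> is \<open>l2 / l1\<close>, so the linear term
        subtracted in \<open>F\<close> is restored.\<close>
      have "deriv g x = F x (w x) + l2 / l1 * w x"
        using deriv_g[OF x] weq[OF x] \<mu> by (simp add: algebra_simps)
      then show ?thesis using rnz[OF x w3[OF x] False] False by (simp add: F_def g_def)
    qed
  qed
qed

lemma order_ge_2_swap: 
  assumes "order_ge_2 \<phi>"
  shows "order_ge_2 (\<lambda>p. \<phi> (prod.swap p))"
proof -
  have "((\<lambda>p. prod.swap p) has_derivative (\<lambda>p. prod.swap p)) (at (0::C2))"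
    unfolding prod.swap_def by (auto intro!: derivative_eq_intros)
  from has_derivative_compose[OF this, of \<phi> "\<lambda>_. 0"] assms show ?thesis
    by (simp add: order_ge_2_def zero_prod_def)
qed

section \<open>Separatrices\<close>

lemma isCont_imp_tendsto_nhds:
  assumes "isCont f a" "f a = l"
  shows "(f \<longlongrightarrow> l) (nhds a)"
  using assms tendsto_at_iff_tendsto_nhds[of f a] by (simp add: continuous_at)

text \<open>A defining function restricted to the curve is holomorphic in one variable, so it
  vanishes identically or has isolated zeros. The second alternative is punctured because the origin
  itself may lie in \<open>A\<close>.\<close>

lemma analytic_germ_along_curve:
  assumes A: "analytic_germ A" and r: "r > 0"
    and x: "x holomorphic_on ball 0 r" "x 0 = 0" and y: "y holomorphic_on ball 0 r" "y 0 = 0"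
  shows "(\<forall>\<^sub>F s in nhds 0. (x s, y s) \<in> A) \<or> (\<forall>\<^sub>F s in at 0. (x s, y s) \<notin> A)"
proof -
  obtain U F where U: "open U" "0 \<in> U" and F: "\<And>f. f \<in> F \<Longrightarrow> holo_on f U"
    and A_eq: "A \<inter> U = {p \<in> U. \<forall>f\<in>F. f p = 0}"
    using A by (auto simp: analytic_germ_def)
  have "isCont x 0" "isCont y 0"
    using x(1) y(1) r by (auto dest!: holomorphic_on_imp_continuous_on simp: continuous_on_eq_continuous_at)
  then have "isCont (\<lambda>s. (x s, y s)) 0" by (intro continuous_intros)
  then have "((\<lambda>s. (x s, y s)) \<longlongrightarrow> 0) (nhds 0)"
    using x y by (intro isCont_imp_tendsto_nhds) (simp_all add: zero_prod_def)
  then have "\<forall>\<^sub>F s in nhds 0. (x s, y s) \<in> U" using U by (auto dest: topological_tendstoD)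
  then obtain d where d: "d > 0" "\<And>s. s \<in> ball 0 d \<Longrightarrow> (x s, y s) \<in> U"
    by (auto simp: eventually_nhds_metric dist_commute)
  define e where "e = min d r"
  have e: "e > 0" "\<And>s. s \<in> ball 0 e \<Longrightarrow> (x s, y s) \<in> U" using d r by (auto simp: e_def)
  show ?thesis
  proof (cases "\<forall>f\<in>F. \<forall>s\<in>ball 0 e. f (x s, y s) = 0")
    case True
    then have "(x s, y s) \<in> A" if "s \<in> ball 0 e" for s using A_eq e(2)[OF that] that by blast
    then show ?thesis using eventually_nhds_in_open[OF open_ball, of 0 0 e] e(1)
      by (auto elim: eventually_mono)
  next
    case False
    then obtain f s where f: "f \<in> F" "s \<in> ball 0 e" "f (x s, y s) \<noteq> 0" by blast
    have "(\<lambda>s. f (x s, y s)) holomorphic_on ball 0 e"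
      using x y by (intro holo_on_curve[OF F[OF f(1)] _ _ open_ball e(2)])
                   (auto simp: e_def intro: holomorphic_on_subset)
    from non_zero_neighbour_alt[OF this open_ball connected_ball _ f(2,3), of 0]
    have "\<forall>\<^sub>F s in at 0. f (x s, y s) \<noteq> 0 \<and> s \<in> ball 0 e" using e(1) by simp
    then have "\<forall>\<^sub>F s in at 0. (x s, y s) \<notin> A"
      by eventually_elim (use A_eq f(1) e(2) in blast)
    then show ?thesis ..
  qed
qed

text \<open>If both \<open>A\<close> and \<open>B\<close> missed the curve for small nonzero s, so
  would \<open>C\<close>. Hence one of them contains the curve near 0 and, lying in the union, has
  the germ of \<open>C\<close>. The map \<open>\<pi>\<close> recovers the parameter of a point and
  sends points near the origin to parameters near 0.\<close>

lemma irreducible_germ_parametrized: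
  assumes r: "r > 0"
    and x: "x holomorphic_on ball 0 r" "x 0 = 0" and y: "y holomorphic_on ball 0 r" "y 0 = 0"
    and C: "\<And>s. s \<in> ball 0 r \<Longrightarrow> (x s, y s) \<in> C"
    and \<pi>: "(\<pi> \<longlongrightarrow> 0) (nhds 0)" "\<And>p. p \<in> C \<Longrightarrow> (x (\<pi> p), y (\<pi> p)) = p"
  shows "irreducible_germ C"
  unfolding irreducible_germ_def
proof (intro allI impI, elim conjE)
  fix A B assume A: "analytic_germ A" and B: "analytic_germ B" and AB: "germ_eq C (A \<union> B)"
  have sub: "germ_eq C D" if D: "\<forall>\<^sub>F s in nhds 0. (x s, y s) \<in> D" "D \<subseteq> A \<union> B" for D
  proof -
    have "\<forall>\<^sub>F p in nhds 0. (x (\<pi> p), y (\<pi> p)) \<in> D"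
      using eventually_compose_filterlim[OF D(1) \<pi>(1)] .
    with AB[unfolded germ_eq_def] show ?thesis
      unfolding germ_eq_def by eventually_elim (use D(2) \<pi>(2) in fastforce)
  qed
  have "isCont x 0" "isCont y 0"
    using x(1) y(1) r by (auto dest!: holomorphic_on_imp_continuous_on simp: continuous_on_eq_continuous_at)
  then have "((\<lambda>s. (x s, y s)) \<longlongrightarrow> 0) (at 0)"
    using x y by (auto simp: continuous_at zero_prod_def intro!: tendsto_Pair)
  from eventually_compose_filterlim[OF AB[unfolded germ_eq_def] this]
  have ev: "\<forall>\<^sub>F s in at 0. (x s, y s) \<in> C \<longleftrightarrow> (x s, y s) \<in> A \<union> B" .
  have evC: "\<forall>\<^sub>F s in at 0. (x s, y s) \<in> C"
    using eventually_at_in_open'[OF open_ball, of 0 0 r] r C by (auto elim: eventually_mono)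
  have "\<not> ((\<forall>\<^sub>F s in at 0. (x s, y s) \<notin> A) \<and> (\<forall>\<^sub>F s in at 0. (x s, y s) \<notin> B))"
  proof (intro notI, elim conjE)
    assume "\<forall>\<^sub>F s in at 0. (x s, y s) \<notin> A" "\<forall>\<^sub>F s in at 0. (x s, y s) \<notin> B"
    with ev evC have "\<forall>\<^sub>F s in at (0::complex). False" by eventually_elim auto
    then show False by simp
  qed
  then show "germ_eq C A \<or> germ_eq C B"
    using analytic_germ_along_curve[OF A r x y] analytic_germ_along_curve[OF B r x y] sub by blast
qed

text \<open>The common form of the two graphs. The gradient \<open>(a p, b p)\<close> of
  \<open>f\<close> is nonzero all along \<open>C\<close>, so \<open>f\<close> itself serves as
  regular equation at every point when tangency of \<open>X\<close> is tested.\<close>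

lemma separatrix_parametrized:
  assumes f: "holo_on f U" "0 \<in> U" and C_def: "C = {p \<in> U. f p = 0}"
    and df: "\<And>p. p \<in> C \<Longrightarrow> (f has_derivative (\<lambda>(u, v). a p * u + b p * v)) (at p)"
            "\<And>p. p \<in> C \<Longrightarrow> (a p, b p) \<noteq> (0, 0)"
    and X: "\<And>p. p \<in> C \<Longrightarrow> a p * fst (X p) + b p * snd (X p) = 0"
    and r: "r > 0"
    and x: "x holomorphic_on ball 0 r" "x 0 = 0" and y: "y holomorphic_on ball 0 r" "y 0 = 0"
    and C: "\<And>s. s \<in> ball 0 r \<Longrightarrow> (x s, y s) \<in> C"
    and \<pi>: "(\<pi> \<longlongrightarrow> 0) (nhds 0)" "\<And>p. p \<in> C \<Longrightarrow> (x (\<pi> p), y (\<pi> p)) = p"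
  shows "separatrix X C" "smooth_curve_at C 0"
proof -
  have C0: "0 \<in> C" using C[of 0] r x y by (simp add: zero_prod_def)
  then have f0: "f 0 = 0" by (simp add: C_def)
  have reg: "regular_equation_at C p f (a p) (b p)" if "p \<in> C" for p
    unfolding regular_equation_at_def
    using that df[OF that] f(1) by (auto simp: C_def)
  show "smooth_curve_at C 0" using reg[OF C0] unfolding smooth_curve_at_def by blast
  \<comment> \<open>Were \<open>f\<close> zero near the origin, its derivative there would vanish,
    against the nonzero gradient.\<close>
  have "\<exists>\<^sub>F p in nhds 0. f p \<noteq> 0"
    unfolding frequently_def
  proof
    assume "\<forall>\<^sub>F p in nhds 0. \<not> f p \<noteq> 0"
    then have "\<forall>\<^sub>F p in at 0. 0 = f p" by (auto simp: eventually_at_filter elim: eventually_mono)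
    then have "(f has_derivative (\<lambda>_. 0)) (at 0)"
      by (rule has_derivative_transform_eventually[of "\<lambda>_. 0", OF has_derivative_const]) (simp_all add: f0)
    from has_derivative_unique[OF df(1)[OF C0] this]
    have "(case p of (u, v) \<Rightarrow> a 0 * u + b 0 * v) = 0" for p by metis
    from this[of "(1, 0)"] this[of "(0, 1)"] df(2)[OF C0] show False by simp
  qed
  then have "analytic_curve_germ C"
    unfolding analytic_curve_germ_def using f f0 by (auto simp: C_def)
  moreover have "invariant_germ X C"
    unfolding invariant_germ_def
  proof (intro always_eventually allI impI)
    fix p assume "smooth_curve_at C p"
    then have "p \<in> C" by (auto simp: smooth_curve_at_def regular_equation_at_def)
    then show "X p \<in> tangent_line C p"
      using reg[of p] X[of p] unfolding tangent_line_def case_prod_unfold by blast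
  qed
  ultimately show "separatrix X C"
    unfolding separatrix_def using irreducible_germ_parametrized[OF r x y C \<pi>] by blast
qed

text \<open>\<open>tangent_line\<close> ranges over all regular equations, so bounding it from above
  means treating an arbitrary one. Since \<open>f\<close> vanishes along the curve, its differential
  kills the velocity.\<close>

lemma regular_equation_at_parametrized:
  assumes reg: "regular_equation_at C 0 f a b"
    and r: "r > 0" and C: "\<And>s. s \<in> ball 0 r \<Longrightarrow> (x s, y s) \<in> C"
    and x: "(x has_field_derivative x') (at 0)" "x 0 = 0"
    and y: "(y has_field_derivative y') (at 0)" "y 0 = 0"
  shows "a * x' + b * y' = 0"
proof -
  obtain U where U: "0 \<in> U" "holo_on f U" "C \<inter> U = {q \<in> U. f q = 0}"
    and df: "(f has_derivative (\<lambda>(u, v). a * u + b * v)) (at 0)"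
    using reg by (auto simp: regular_equation_at_def)
  have "((\<lambda>s. (x s, y s)) \<longlongrightarrow> (x 0, y 0)) (nhds 0)"
    using x y by (intro tendsto_Pair isCont_imp_tendsto_nhds) (auto dest: DERIV_isCont)
  then have "\<forall>\<^sub>F s in nhds 0. (x s, y s) \<in> U"
    using U x y by (intro topological_tendstoD) (auto simp: holo_on_def zero_prod_def)
  moreover have "\<forall>\<^sub>F s in nhds 0. s \<in> ball 0 r" using r by (intro eventually_nhds_in_open) auto
  ultimately have ev: "\<forall>\<^sub>F s in nhds 0. f (x s, y s) = 0"
    by eventually_elim (use U(3) C in blast)
  have "((\<lambda>s. f (x s, y s)) has_field_derivative a * x' + b * y') (at 0)"
    using x y df by (intro has_field_derivative_curve) (auto simp: zero_prod_def)
  moreover have "((\<lambda>s. f (x s, y s)) has_field_derivative 0) (at 0)"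
    by (subst DERIV_cong_ev[OF refl ev refl]) simp
  ultimately show ?thesis by (rule DERIV_unique)
qed

lemma zero_in_tangent_line: "smooth_curve_at C p \<Longrightarrow> 0 \<in> tangent_line C p"
  by (auto simp: smooth_curve_at_def tangent_line_def zero_prod_def)

text \<open>The equation \<open>y - g x\<close> has second partial derivative 1, hence a nonzero
  gradient, and \<open>fst\<close> recovers the parameter. An inclusion for the tangent line is
  enough: the two lines then meet at most in 0.\<close>

lemma graph_separatrix:
  assumes r: "r > 0" and g: "g holomorphic_on ball 0 r" "g 0 = 0" "deriv g 0 = 0"
    and X: "\<And>x. x \<in> ball 0 r \<Longrightarrow> snd (X (x, g x)) = deriv g x * fst (X (x, g x))"
  defines "C \<equiv> {p. fst p \<in> ball 0 r \<and> snd p = g (fst p)}"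
  shows "separatrix X C" "smooth_curve_at C 0" "tangent_line C 0 \<subseteq> {p. snd p = 0}"
proof -
  let ?U = "fst -` ball 0 r :: C2 set"
  let ?f = "\<lambda>p. snd p - g (fst p)"
  have U: "open ?U" by (intro open_vimage continuous_intros) auto
  have dg: "(g has_field_derivative deriv g s) (at s)" if "s \<in> ball 0 r" for s
    using holomorphic_derivI[OF g(1) open_ball that] .
  have dg0: "(g has_field_derivative 0) (at 0)" using dg[of 0] r g(3) by simp
  have CU: "C = {p \<in> ?U. ?f p = 0}" by (auto simp: C_def)
  have f: "holo_on ?f ?U"
    by (intro holo_on_diff holo_on_snd U holo_on_compose_holomorphic[OF g(1)] holo_on_fst) auto
  have df: "(?f has_derivative (\<lambda>(u, v). - deriv g (fst p) * u + 1 * v)) (at p)" if "p \<in> C" for p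
  proof -
    have "((\<lambda>p. g (fst p)) has_derivative (\<lambda>q. deriv g (fst p) * fst q)) (at p)"
      using that has_derivative_compose[OF has_derivative_fst[OF has_derivative_ident]
              dg[of "fst p", unfolded has_field_derivative_def]] by (auto simp: C_def)
    then have "(?f has_derivative (\<lambda>q. snd q - deriv g (fst p) * fst q)) (at p)"
      by (intro has_derivative_diff has_derivative_snd has_derivative_ident)
    then show ?thesis by (rule has_derivative_eq_rhs) auto
  qed
  have lim: "(fst \<longlongrightarrow> (0::complex)) (nhds (0::C2))"
    using tendsto_fst[OF filterlim_ident, of "0::C2"] by simp
  have U0: "0 \<in> ?U" using r by simp
  have id: "(\<lambda>s. s) holomorphic_on ball 0 r" by (rule holomorphic_on_ident)
  have inC: "(s, g s) \<in> C" if "s \<in> ball 0 r" for s using that by (simp add: C_def)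
  have Xt: "- deriv g (fst p) * fst (X p) + 1 * snd (X p) = 0" if "p \<in> C" for p
    using X[of "fst p"] that by (cases p) (auto simp: C_def)
  have fstC: "(fst p, g (fst p)) = p" if "p \<in> C" for p
    using that by (auto simp: C_def prod_eq_iff)
  note * = separatrix_parametrized[where x = "\<lambda>s. s" and \<pi> = fst and X = X, 
      OF f U0 CU df _ Xt r id refl g(1,2) inC lim fstC]
  show "separatrix X C" "smooth_curve_at C 0" using * by auto
  show "tangent_line C 0 \<subseteq> {p. snd p = 0}"
  proof
    fix p assume "p \<in> tangent_line C 0"
    then obtain f a b where reg: "regular_equation_at C 0 f a b" and p: "a * fst p + b * snd p = 0"
      by (auto simp: tangent_line_def)
    from regular_equation_at_parametrized[OF reg r inC DERIV_ident refl dg0 g(2)]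
    have "a = 0" by simp
    then show "p \<in> {p. snd p = 0}" using p reg by (auto simp: regular_equation_at_def)
  qed
qed

text \<open>The mirror image, with the equation \<open>x - g y\<close> and the projection
  \<open>snd\<close>.\<close>

lemma swapped_graph_separatrix:
  assumes r: "r > 0" and g: "g holomorphic_on ball 0 r" "g 0 = 0" "deriv g 0 = 0"
    and X: "\<And>y. y \<in> ball 0 r \<Longrightarrow> fst (X (g y, y)) = deriv g y * snd (X (g y, y))"
  defines "C \<equiv> {p. snd p \<in> ball 0 r \<and> fst p = g (snd p)}"
  shows "separatrix X C" "smooth_curve_at C 0" "tangent_line C 0 \<subseteq> {p. fst p = 0}"
proof -
  let ?U = "snd -` ball 0 r :: C2 set"
  let ?f = "\<lambda>p. fst p - g (snd p)"
  have U: "open ?U" by (intro open_vimage continuous_intros) auto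
  have dg: "(g has_field_derivative deriv g s) (at s)" if "s \<in> ball 0 r" for s
    using holomorphic_derivI[OF g(1) open_ball that] .
  have dg0: "(g has_field_derivative 0) (at 0)" using dg[of 0] r g(3) by simp
  have CU: "C = {p \<in> ?U. ?f p = 0}" by (auto simp: C_def)
  have f: "holo_on ?f ?U"
    by (intro holo_on_diff holo_on_fst U holo_on_compose_holomorphic[OF g(1)] holo_on_snd) auto
  have df: "(?f has_derivative (\<lambda>(u, v). 1 * u + - deriv g (snd p) * v)) (at p)" if "p \<in> C" for p
  proof -
    have "((\<lambda>p. g (snd p)) has_derivative (\<lambda>q. deriv g (snd p) * snd q)) (at p)"
      using that has_derivative_compose[OF has_derivative_snd[OF has_derivative_ident]
              dg[of "snd p", unfolded has_field_derivative_def]] by (auto simp: C_def)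
    then have "(?f has_derivative (\<lambda>q. fst q - deriv g (snd p) * snd q)) (at p)"
      by (intro has_derivative_diff has_derivative_fst has_derivative_ident)
    then show ?thesis by (rule has_derivative_eq_rhs) auto
  qed
  have lim: "(snd \<longlongrightarrow> (0::complex)) (nhds (0::C2))"
    using tendsto_snd[OF filterlim_ident, of "0::C2"] by simp
  have U0: "0 \<in> ?U" using r by simp
  have id: "(\<lambda>s. s) holomorphic_on ball 0 r" by (rule holomorphic_on_ident)
  have inC: "(g s, s) \<in> C" if "s \<in> ball 0 r" for s using that by (simp add: C_def)
  have Xt: "1 * fst (X p) + - deriv g (snd p) * snd (X p) = 0" if "p \<in> C" for p
    using X[of "snd p"] that by (cases p) (auto simp: C_def)
  have sndC: "(g (snd p), snd p) = p" if "p \<in> C" for p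
    using that by (auto simp: C_def prod_eq_iff)
  note * = separatrix_parametrized[where y = "\<lambda>s. s" and \<pi> = snd and X = X, 
      OF f U0 CU df _ Xt r g(1,2) id refl inC lim sndC]
  show "separatrix X C" "smooth_curve_at C 0" using * by auto
  show "tangent_line C 0 \<subseteq> {p. fst p = 0}"
  proof
    fix p assume "p \<in> tangent_line C 0"
    then obtain f a b where reg: "regular_equation_at C 0 f a b" and p: "a * fst p + b * snd p = 0"
      by (auto simp: tangent_line_def)
    from regular_equation_at_parametrized[OF reg r inC dg0 g(2) DERIV_ident refl]
    have "b = 0" by simp
    then show "p \<in> {p. fst p = 0}" using p reg by (auto simp: regular_equation_at_def)
  qed
qed

section \<open>Straightening the invariant curves\<close>

lemma bounded_linear_shear:
  "bounded_linear (\<lambda>(u, v). (u - a * v, v - b * u) :: C2)"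
  by (intro bounded_linear_intros | simp add: case_prod_unfold)+

text \<open>The inverse function theorem describes the derivative of the inverse map as an abstract
  \<open>inv\<close> of a real linear map. Writing out the 2 by 2 inverse, with \<open>c\<close> the
  reciprocal determinant, shows that it is complex linear.\<close>

lemma inv_shear:
  fixes a b :: complex
  assumes "bij (\<lambda>(u, v). (u - a * v, v - b * u))"
  obtains c where "inv (\<lambda>(u, v). (u - a * v, v - b * u)) =
                   (\<lambda>(u, v). (c * u + c * a * v, c * b * u + c * v))"
proof -
  \<comment> \<open>With determinant 0 the vector \<open>(a, 1)\<close> would be sent to the
    origin.\<close>
  have "(\<lambda>(u, v). (u - a * v, v - b * u)) (a, 1) \<noteq> (\<lambda>(u, v). (u - a * v, v - b * u)) (0, 0)"
    using bij_is_inj[OF assms] by (subst inj_eq) auto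
  then have ab: "1 - a * b \<noteq> 0" by (simp add: mult.commute)
  define c where "c = 1 / (1 - a * b)"
  have c: "c * (1 - a * b) = 1" using ab by (simp add: c_def)
  have cu: "c * u - c * a * b * u = u" for u
  proof -
    have "c * u - c * a * b * u = c * (1 - a * b) * u" by (simp add: algebra_simps)
    then show ?thesis by (simp add: c)
  qed
  have left: "c * (u - a * v) + c * a * (v - b * u) = u"
    and left': "c * b * (u - a * v) + c * (v - b * u) = v" for u v
    by (rule trans[OF _ cu], simp add: algebra_simps)+
  have right: "c * u + c * a * v - a * (c * b * u + c * v) = u"
    and right': "c * b * u + c * v - b * (c * u + c * a * v) = v" for u v
    by (rule trans[OF _ cu], simp add: algebra_simps)+
  have "inv (\<lambda>(u, v). (u - a * v, v - b * u)) = (\<lambda>(u, v). (c * u + c * a * v, c * b * u + c * v))"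
    by (rule inv_equality) (simp_all only: split_beta fst_conv snd_conv left left' right right' prod.collapse)
  then show ?thesis by (rule that)
qed

text \<open>The derivative of \<open>\<Phi>\<close> at the origin is the identity because
  \<open>g1\<close> and \<open>g2\<close> have derivative 0 there, so the inverse function theorem
  applies; \<open>inv_shear\<close> upgrades its real inverse to a holomorphic one.\<close>

lemma straightening:
  fixes g1 g2 :: "complex \<Rightarrow> complex" and U :: "C2 set"
  assumes U: "open U" "0 \<in> U" and r: "r1 > 0" "r2 > 0"
    and g1: "g1 holomorphic_on ball 0 r1" "g1 0 = 0" "deriv g1 0 = 0"
    and g2: "g2 holomorphic_on ball 0 r2" "g2 0 = 0" "deriv g2 0 = 0"
  defines "\<Phi> \<equiv> \<lambda>p. (fst p - g2 (snd p), snd p - g1 (fst p))"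
  obtains V W \<Psi> where "V \<subseteq> U \<inter> (ball 0 r1 \<times> ball 0 r2)" "open V" "0 \<in> V"
    "coordinate_change \<Phi> V W" "homeomorphism V W \<Phi> \<Psi>" "holo_map_on \<Psi> W"
    "\<And>p. p \<in> V \<Longrightarrow> frechet_derivative \<Phi> (at p) =
            (\<lambda>(u, v). (u - deriv g2 (snd p) * v, v - deriv g1 (fst p) * u))"
proof -
  define S where "S = U \<inter> (ball 0 r1 \<times> ball 0 r2)"
  have S: "open S" "0 \<in> S" using U r by (auto simp: S_def zero_prod_def intro!: open_Int open_Times)
  define D where "D p = (\<lambda>(u, v). (u - deriv g2 (snd p) * v, v - deriv g1 (fst p) * u))" for p
  have blD: "bounded_linear (D p)" for p unfolding D_def by (rule bounded_linear_shear)
  define D' where "D' p = Blinfun (D p)" for p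
  have D': "blinfun_apply (D' p) = D p" for p
    unfolding D'_def by (rule bounded_linear_Blinfun_apply[OF blD])
  have dg1: "(g1 has_field_derivative deriv g1 s) (at s)" if "s \<in> ball 0 r1" for s
    using holomorphic_derivI[OF g1(1) open_ball that] .
  have dg2: "(g2 has_field_derivative deriv g2 s) (at s)" if "s \<in> ball 0 r2" for s
    using holomorphic_derivI[OF g2(1) open_ball that] .
  have d\<Phi>: "(\<Phi> has_derivative D p) (at p)" if "p \<in> S" for p
  proof -
    have "((\<lambda>p. g2 (snd p)) has_derivative (\<lambda>q. deriv g2 (snd p) * snd q)) (at p)"
      using that has_derivative_compose[OF has_derivative_snd[OF has_derivative_ident]
          dg2[of "snd p", unfolded has_field_derivative_def]] by (auto simp: S_def)
    moreover have "((\<lambda>p. g1 (fst p)) has_derivative (\<lambda>q. deriv g1 (fst p) * fst q)) (at p)"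
      using that has_derivative_compose[OF has_derivative_fst[OF has_derivative_ident]
          dg1[of "fst p", unfolded has_field_derivative_def]] by (auto simp: S_def)
    ultimately have "(\<Phi> has_derivative
        (\<lambda>q. (fst q - deriv g2 (snd p) * snd q, snd q - deriv g1 (fst p) * fst q))) (at p)"
      unfolding \<Phi>_def
      by (intro has_derivative_Pair has_derivative_diff has_derivative_fst has_derivative_snd has_derivative_ident)
    then show ?thesis by (rule has_derivative_eq_rhs) (auto simp: D_def)
  qed
  have contD': "continuous_on S D'"
  proof (rule continuous_on_blinfun_componentwise)
    fix i :: C2
    have "continuous_on S (\<lambda>p. deriv g2 (snd p))" "continuous_on S (\<lambda>p. deriv g1 (fst p))"
      by (rule continuous_on_compose2[OF holomorphic_on_imp_continuous_on[OF holomorphic_deriv[OF _ open_ball]]],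
          rule g1 g2, intro continuous_intros, force simp: S_def)+
    then show "continuous_on S (\<lambda>p. blinfun_apply (D' p) i)"
      unfolding D' D_def split_beta by (intro continuous_intros)
  qed
  have "D' 0 = id_blinfun"
    by (rule blinfun_eqI) (simp add: D' D_def g1 g2)
  then have inv0: "id_blinfun o\<^sub>L D' 0 = id_blinfun" by (simp add: blinfun_eqI)
  have d\<Phi>': "(\<Phi> has_derivative blinfun_apply (D' p)) (at p)" if "p \<in> S" for p
    using d\<Phi>[OF that] by (simp add: D')
  obtain V W \<Psi> \<Psi>' where V: "open V" "V \<subseteq> S" "0 \<in> V" "open W" and "\<Phi> 0 \<in> W"
    and hom: "homeomorphism V W \<Phi> \<Psi>"
    and \<Psi>1: "\<And>y. y \<in> W \<Longrightarrow> (\<Psi> has_derivative \<Psi>' y) (at y)"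
    and \<Psi>2: "\<And>y. y \<in> W \<Longrightarrow> \<Psi>' y = inv (blinfun_apply (D' (\<Psi> y)))"
    and \<Psi>3: "\<And>y. y \<in> W \<Longrightarrow> bij (blinfun_apply (D' (\<Psi> y)))"
    by (rule inverse_function_theorem[OF S(1) d\<Phi>' contD' S(2) inv0]) (assumption, rule that)
  have \<Psi>'_eq: "\<exists>a b c d. \<Psi>' y = (\<lambda>(u, v). (a * u + b * v, c * u + d * v))" if y: "y \<in> W" for y
  proof -
    obtain c where "inv (D (\<Psi> y)) = (\<lambda>(u, v). (c * u + c * deriv g2 (snd (\<Psi> y)) * v,
        c * deriv g1 (fst (\<Psi> y)) * u + c * v))"
      using inv_shear[OF \<Psi>3[OF y, unfolded D' D_def]] unfolding D_def by blast
    then show ?thesis unfolding \<Psi>2[OF y, unfolded D'] by (intro exI)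
  qed
  have holo_\<Psi>: "holo_map_on \<Psi> W"
    unfolding holo_map_on_def holo_on_def
  proof (intro conjI V ballI)
    fix y assume y: "y \<in> W"
    obtain a b c d where eq: "\<Psi>' y = (\<lambda>(u, v). (a * u + b * v, c * u + d * v))"
      using \<Psi>'_eq[OF y] by blast
    have "((\<lambda>y. fst (\<Psi> y)) has_derivative (\<lambda>(u, v). a * u + b * v)) (at y)"
      by (rule has_derivative_eq_rhs[OF has_derivative_fst[OF \<Psi>1[OF y]]]) (auto simp: eq)
    then show "\<exists>a b. ((\<lambda>y. fst (\<Psi> y)) has_derivative (\<lambda>(u, v). a * u + b * v)) (at y)" by blast
    have "((\<lambda>y. snd (\<Psi> y)) has_derivative (\<lambda>(u, v). c * u + d * v)) (at y)"
      by (rule has_derivative_eq_rhs[OF has_derivative_snd[OF \<Psi>1[OF y]]]) (auto simp: eq)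
    then show "\<exists>a b. ((\<lambda>y. snd (\<Psi> y)) has_derivative (\<lambda>(u, v). a * u + b * v)) (at y)" by blast
  qed
  have holo_\<Phi>: "holo_map_on \<Phi> V"
    unfolding holo_map_on_def \<Phi>_def fst_conv snd_conv using V(2)
    by (intro conjI holo_on_diff holo_on_fst holo_on_snd V
          holo_on_compose_holomorphic[OF g1(1)] holo_on_compose_holomorphic[OF g2(1)]) (auto simp: S_def)
  have inj: "inj_on \<Phi> V" and im: "\<Phi> ` V = W"
    using hom by (auto simp: homeomorphism_def intro: inj_on_inverseI)
  have inv_eq: "\<Psi> y = the_inv_into V \<Phi> y" if "y \<in> W" for y
    using hom that inj by (intro the_inv_into_f_eq[symmetric]) (auto simp: homeomorphism_def)
  have "holo_map_on (the_inv_into V \<Phi>) W"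
    using holo_\<Psi> unfolding holo_map_on_def by (auto simp: inv_eq elim: holo_on_cong)
  moreover have "bij_betw \<Phi> V W" using inj im by (simp add: bij_betw_def)
  moreover have "\<Phi> 0 = 0" by (simp add: \<Phi>_def g1 g2 zero_prod_def)
  ultimately have "coordinate_change \<Phi> V W"
    using V holo_\<Phi> by (simp add: coordinate_change_def)
  moreover have "frechet_derivative \<Phi> (at p) =
            (\<lambda>(u, v). (u - deriv g2 (snd p) * v, v - deriv g1 (fst p) * u))" if "p \<in> V" for p
    using frechet_derivative_at[OF d\<Phi>[of p]] that V by (auto simp: D_def)
  ultimately show ?thesis using that[OF V(2)[unfolded S_def] V(1,3) _ hom holo_\<Psi>] by blast
qed

section \<open>The normal form and the two transverse separatrices\<close>

theorem lemma2p2: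
  fixes X :: "C2 \<Rightarrow> C2" and \<phi>1 \<phi>2 :: "C2 \<Rightarrow> complex"
    and l1 l2 :: complex and U :: "C2 set"
  assumes "open U" and "0 \<in> U"
    and "holo_on \<phi>1 U" and "holo_on \<phi>2 U"
    and "order_ge_2 \<phi>1" and "order_ge_2 \<phi>2"
    and "\<And>x1 x2. (x1, x2) \<in> U \<Longrightarrow>
           X (x1, x2) = (l1 * x1 + \<phi>1 (x1, x2), l2 * x2 + \<phi>2 (x1, x2))"
    and "l1 \<noteq> 0" and "l2 \<noteq> 0"
    and "l1 / l2 \<in> complex_of_real ` {..<0}"
  shows "(\<exists>V W \<Phi> h1 h2. V \<subseteq> U \<and> coordinate_change \<Phi> V W \<and>
            higher_order_terms_on h1 W \<and> higher_order_terms_on h2 W \<and>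
            expressed_as X \<Phi> V
              (\<lambda>(y1, y2). (l1 * y1 * (1 + h1 (y1, y2)), l2 * y2 * (1 + h2 (y1, y2))))) \<and>
         (\<exists>C1 C2. separatrix X C1 \<and> separatrix X C2 \<and>
            smooth_curve_at C1 0 \<and> smooth_curve_at C2 0 \<and> transverse_at_0 C1 C2)"
proof -
  note U = \<open>open U\<close> \<open>0 \<in> U\<close>
  note \<phi>1 = \<open>holo_on \<phi>1 U\<close> \<open>order_ge_2 \<phi>1\<close> and \<phi>2 = \<open>holo_on \<phi>2 U\<close> \<open>order_ge_2 \<phi>2\<close>
  note X = assms(7)
  obtain \<mu> where \<mu>: "l1 / l2 = complex_of_real \<mu>" "\<mu> < 0" using assms(10) by auto
  then have "l2 / l1 = complex_of_real (inverse \<mu>)"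
    by (metis inverse_divide of_real_inverse)
  then have neg: "l2 / l1 \<in> complex_of_real ` {..<0}" using \<mu>(2) by (simp del: of_real_inverse)
  obtain r1 g1 where r1: "r1 > 0" and g1: "g1 holomorphic_on ball 0 r1" "g1 0 = 0" "deriv g1 0 = 0"
    and g1U: "\<And>x. x \<in> ball 0 r1 \<Longrightarrow> (x, g1 x) \<in> U"
    and g1eq: "\<And>x. x \<in> ball 0 r1 \<Longrightarrow>
       l2 * g1 x + \<phi>2 (x, g1 x) = deriv g1 x * (l1 * x + \<phi>1 (x, g1 x))"
    by (rule invariant_graph[OF U \<phi>1(1) \<phi>2(1) \<phi>1(2) \<phi>2(2) \<open>l1 \<noteq> 0\<close> neg]) blast
  \<comment> \<open>The second curve is a graph over the other axis: exchanging the coordinates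
    exchanges \<open>\<phi>1\<close> with \<open>\<phi>2\<close> and inverts the eigenvalue ratio,
    which stays negative.\<close>
  have U': "open (prod.swap -` U)" "0 \<in> prod.swap -` U"
    using holo_on_swap[OF \<phi>1(1)] U by (auto simp: holo_on_def zero_prod_def)
  obtain r2 g2 where r2: "r2 > 0" and g2: "g2 holomorphic_on ball 0 r2" "g2 0 = 0" "deriv g2 0 = 0"
    and g2U': "\<And>y. y \<in> ball 0 r2 \<Longrightarrow> (y, g2 y) \<in> prod.swap -` U"
    and g2eq': "\<And>y. y \<in> ball 0 r2 \<Longrightarrow> l1 * g2 y + \<phi>1 (prod.swap (y, g2 y)) =
       deriv g2 y * (l2 * y + \<phi>2 (prod.swap (y, g2 y)))"
    by (rule invariant_graph[OF U' holo_on_swap[OF \<phi>2(1)] holo_on_swap[OF \<phi>1(1)]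
          order_ge_2_swap[OF \<phi>2(2)] order_ge_2_swap[OF \<phi>1(2)] \<open>l2 \<noteq> 0\<close> assms(10)]) blast
  have g2U: "(g2 y, y) \<in> U" if "y \<in> ball 0 r2" for y using g2U'[OF that] by simp
  have g2eq: "l1 * g2 y + \<phi>1 (g2 y, y) = deriv g2 y * (l2 * y + \<phi>2 (g2 y, y))"
    if "y \<in> ball 0 r2" for y using g2eq'[OF that] by simp
  define \<Phi> where "\<Phi> = (\<lambda>p. (fst p - g2 (snd p), snd p - g1 (fst p)))"
  obtain V W \<Psi> where V: "V \<subseteq> U \<inter> (ball 0 r1 \<times> ball 0 r2)" "open V" "0 \<in> V"
    and cc: "coordinate_change \<Phi> V W" and hom: "homeomorphism V W \<Phi> \<Psi>" and \<Psi>: "holo_map_on \<Psi> W"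
    and d\<Phi>: "\<And>p. p \<in> V \<Longrightarrow> frechet_derivative \<Phi> (at p) =
            (\<lambda>(u, v). (u - deriv g2 (snd p) * v, v - deriv g1 (fst p) * u))"
    unfolding \<Phi>_def by (rule straightening[OF U r1 r2 g1 g2]) blast
  have \<Phi>0: "\<Phi> 0 = 0" using cc by (simp add: coordinate_change_def)
  have W: "open W" using \<Psi> by (simp add: holo_map_on_def holo_on_def)
  have \<Phi>W: "\<Phi> p \<in> W" "\<Psi> (\<Phi> p) = p" if "p \<in> V" for p using hom that by (auto simp: homeomorphism_def)
  have \<Psi>V: "\<Psi> y \<in> V" "\<Phi> (\<Psi> y) = y" if "y \<in> W" for y using hom that by (auto simp: homeomorphism_def)
  have W0: "0 \<in> W" using \<Phi>W(1)[OF V(3)] \<Phi>0 by simp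
  define X1 where "X1 p = l1 * fst p + \<phi>1 p" for p
  define X2 where "X2 p = l2 * snd p + \<phi>2 p" for p
  have X_eq: "X p = (X1 p, X2 p)" if "p \<in> U" for p
    using X[of "fst p" "snd p"] that by (simp add: X1_def X2_def)
  have X12: "holo_on X1 V" "holo_on X2 V"
    unfolding X1_def X2_def using V \<phi>1 \<phi>2
    by (auto intro!: holo_on_add holo_on_mult holo_on_const holo_on_fst holo_on_snd intro: holo_on_subset)
  \<comment> \<open>\<open>Y1\<close> and \<open>Y2\<close> are the components of the pushed-forward
    field, still read in the old coordinates; composing with \<open>\<Psi>\<close> moves them to
    \<open>W\<close>.\<close>
  define Y1 where "Y1 p = X1 p - deriv g2 (snd p) * X2 p" for p
  define Y2 where "Y2 p = X2 p - deriv g1 (fst p) * X1 p" for p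
  have Y12: "holo_on Y1 V" "holo_on Y2 V"
    unfolding Y1_def Y2_def using V
    by (auto intro!: holo_on_diff holo_on_mult X12 holo_on_fst holo_on_snd
        holo_on_compose_holomorphic[OF holomorphic_deriv[OF g1(1) open_ball]]
        holo_on_compose_holomorphic[OF holomorphic_deriv[OF g2(1) open_ball]])
  have Y\<Psi>: "holo_on (\<lambda>y. Y1 (\<Psi> y)) W" "holo_on (\<lambda>y. Y2 (\<Psi> y)) W"
    using holo_on_compose[OF Y12(1), of "\<lambda>y. fst (\<Psi> y)" W "\<lambda>y. snd (\<Psi> y)"]
          holo_on_compose[OF Y12(2), of "\<lambda>y. fst (\<Psi> y)" W "\<lambda>y. snd (\<Psi> y)"] \<Psi> \<Psi>V(1)
    by (auto simp: holo_map_on_def)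
  \<comment> \<open>Points of \<open>W\<close> with first coordinate 0 come from the curve
    \<open>x = g2 y\<close>, and tangency of \<open>X\<close> to that curve says that
    \<open>Y1\<close> vanishes on it.\<close>
  obtain k1 where k1: "holo_on k1 W" "\<And>y. y \<in> W \<Longrightarrow> Y1 (\<Psi> y) = fst y * k1 y"
  proof (rule holo_on_divide_fst[OF Y\<Psi>(1)])
    fix y2 assume y: "(0, y2) \<in> W"
    then have "fst (\<Psi> (0, y2)) = g2 (snd (\<Psi> (0, y2)))" using \<Psi>V(2)[OF y] by (simp add: \<Phi>_def)
    moreover have "snd (\<Psi> (0, y2)) \<in> ball 0 r2" using \<Psi>V(1)[OF y] V(1) by auto
    ultimately show "Y1 (\<Psi> (0, y2)) = 0"
      using g2eq[of "snd (\<Psi> (0, y2))"] by (cases "\<Psi> (0, y2)") (simp add: Y1_def X1_def X2_def)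
  qed (rule that)
  obtain k2 where k2: "holo_on k2 W" "\<And>y. y \<in> W \<Longrightarrow> Y2 (\<Psi> y) = snd y * k2 y"
  proof (rule holo_on_divide_snd[OF Y\<Psi>(2)])
    fix y1 assume y: "(y1, 0) \<in> W"
    then have "snd (\<Psi> (y1, 0)) = g1 (fst (\<Psi> (y1, 0)))" using \<Psi>V(2)[OF y] by (simp add: \<Phi>_def)
    moreover have "fst (\<Psi> (y1, 0)) \<in> ball 0 r1" using \<Psi>V(1)[OF y] V(1) by auto
    ultimately show "Y2 (\<Psi> (y1, 0)) = 0"
      using g1eq[of "fst (\<Psi> (y1, 0))"] by (cases "\<Psi> (y1, 0)") (simp add: Y2_def X1_def X2_def)
  qed (rule that)
  have Yk: "Y1 p = fst (\<Phi> p) * k1 (\<Phi> p)" "Y2 p = snd (\<Phi> p) * k2 (\<Phi> p)" if "p \<in> V" for p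
    using k1(2) k2(2) \<Phi>W[OF that] by metis+
  have dg0: "(g1 has_field_derivative 0) (at 0)" "(g2 has_field_derivative 0) (at 0)"
    using holomorphic_derivI[OF g1(1) open_ball, of 0] holomorphic_derivI[OF g2(1) open_ball, of 0] r1 r2 g1 g2
    by auto
  have d\<phi>: "(\<phi>1 has_derivative (\<lambda>(u, v). 0 * u + 0 * v)) (at (0, 0))"
           "(\<phi>2 has_derivative (\<lambda>(u, v). 0 * u + 0 * v)) (at (0, 0))"
    using \<phi>1(2) \<phi>2(2) by (simp_all add: order_ge_2_def zero_prod_def case_prod_unfold)
  \<comment> \<open>Evaluate at the image \<open>(s, - g1 s)\<close> of \<open>(s, 0)\<close>: as
    \<open>deriv g2 0 = 0\<close>, there \<open>Y1\<close> is just
    \<open>l1 * s + \<phi>1 (s, 0)\<close>. The value of \<open>k2\<close> comes from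
    \<open>(0, s)\<close> in the same way.\<close>
  have "k1 0 = l1"
  proof (rule quotient_at_0[OF k1(1) W0 DERIV_ident refl, where y = "\<lambda>s. - g1 s" and F = "\<lambda>s. l1 * s + \<phi>1 (s, 0)"])
    show "((\<lambda>s. - g1 s) has_field_derivative - 0) (at 0)" by (rule DERIV_minus[OF dg0(1)])
    have "((\<lambda>s. \<phi>1 (s, 0)) has_field_derivative 0 * 1 + 0 * 0) (at 0)"
      using d\<phi>(1) by (intro has_field_derivative_curve derivative_intros)
    then show "((\<lambda>s. l1 * s + \<phi>1 (s, 0)) has_field_derivative l1) (at 0)"
      by (auto intro!: derivative_eq_intros)
    have "open ((\<lambda>s. (s, 0)) -` V)" by (intro open_vimage V continuous_intros)
    then have "\<forall>\<^sub>F s in nhds 0. (s, 0) \<in> V" using V by (auto dest: eventually_nhds_in_open[of _ 0] simp: zero_prod_def)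
    then show "\<forall>\<^sub>F s in nhds 0. l1 * s + \<phi>1 (s, 0) = s * k1 (s, - g1 s)"
    proof eventually_elim
      case (elim s)
      then show ?case using Yk(1)[OF elim] by (simp add: Y1_def X1_def g2 \<Phi>_def)
    qed
  qed (simp add: g1)
  have "k2 0 = l2"
  proof (rule quotient_at_0[OF k2(1) W0 _ _ DERIV_ident refl, where x = "\<lambda>s. - g2 s" and F = "\<lambda>s. l2 * s + \<phi>2 (0, s)"])
    show "((\<lambda>s. - g2 s) has_field_derivative - 0) (at 0)" by (rule DERIV_minus[OF dg0(2)])
    have "((\<lambda>s. \<phi>2 (0, s)) has_field_derivative 0 * 0 + 0 * 1) (at 0)"
      using d\<phi>(2) by (intro has_field_derivative_curve derivative_intros)
    then show "((\<lambda>s. l2 * s + \<phi>2 (0, s)) has_field_derivative l2) (at 0)"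
      by (auto intro!: derivative_eq_intros)
    have "open ((\<lambda>s. (0, s)) -` V)" by (intro open_vimage V continuous_intros)
    then have "\<forall>\<^sub>F s in nhds 0. (0, s) \<in> V" using V by (auto dest: eventually_nhds_in_open[of _ 0] simp: zero_prod_def)
    then show "\<forall>\<^sub>F s in nhds 0. l2 * s + \<phi>2 (0, s) = s * k2 (- g2 s, s)"
    proof eventually_elim
      case (elim s)
      then show ?case using Yk(2)[OF elim] by (simp add: Y2_def X2_def g1 \<Phi>_def)
    qed
  qed (simp add: g2)
  \<comment> \<open>Chosen so that \<open>l1 * (1 + h1 y) = k1 y\<close>; the value
    \<open>k1 0 = l1\<close> then makes \<open>h1\<close> vanish at the origin.\<close>
  define h1 where "h1 y = 1 / l1 * k1 y - 1" for y
  define h2 where "h2 y = 1 / l2 * k2 y - 1" for y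
  have "holo_on h1 W" "holo_on h2 W"
    unfolding h1_def h2_def by (intro holo_on_diff holo_on_mult holo_on_const k1 k2 W)+
  then have h: "higher_order_terms_on h1 W" "higher_order_terms_on h2 W"
    using \<open>k1 0 = l1\<close> \<open>k2 0 = l2\<close> \<open>l1 \<noteq> 0\<close> \<open>l2 \<noteq> 0\<close>
    by (simp_all add: higher_order_terms_on_def h1_def h2_def)
  have "expressed_as X \<Phi> V (\<lambda>(y1, y2). (l1 * y1 * (1 + h1 (y1, y2)), l2 * y2 * (1 + h2 (y1, y2))))"
    unfolding expressed_as_def
  proof
    fix p assume p: "p \<in> V"
    then have "p \<in> U" using V by blast
    have "frechet_derivative \<Phi> (at p) (X p) = (Y1 p, Y2 p)"
      unfolding d\<Phi>[OF p] X_eq[OF \<open>p \<in> U\<close>] by (simp add: Y1_def Y2_def)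
    also have "\<dots> = (l1 * fst (\<Phi> p) * (1 + h1 (\<Phi> p)), l2 * snd (\<Phi> p) * (1 + h2 (\<Phi> p)))"
      using Yk[OF p] \<open>l1 \<noteq> 0\<close> \<open>l2 \<noteq> 0\<close> by (simp add: h1_def h2_def)
    finally show "frechet_derivative \<Phi> (at p) (X p) =
        (case \<Phi> p of (y1, y2) \<Rightarrow> (l1 * y1 * (1 + h1 (y1, y2)), l2 * y2 * (1 + h2 (y1, y2))))"
      by (simp add: split_beta)
  qed
  moreover have "V \<subseteq> U" using V by blast
  ultimately have part1: "\<exists>V W \<Phi> h1 h2. V \<subseteq> U \<and> coordinate_change \<Phi> V W \<and>
      higher_order_terms_on h1 W \<and> higher_order_terms_on h2 W \<and>
      expressed_as X \<Phi> V (\<lambda>(y1, y2). (l1 * y1 * (1 + h1 (y1, y2)), l2 * y2 * (1 + h2 (y1, y2))))"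
    using cc h by blast
  \<comment> \<open>The separatrices are the full graphs over the two balls, independently of
    \<open>V\<close>; they lie in \<open>U\<close> by \<open>g1U\<close> and \<open>g2U\<close>,
    where the formula for \<open>X\<close> holds.\<close>
  define C1 where "C1 = {p. fst p \<in> ball 0 r1 \<and> snd p = g1 (fst p)}"
  define C2 where "C2 = {p. snd p \<in> ball 0 r2 \<and> fst p = g2 (snd p)}"
  have "snd (X (x, g1 x)) = deriv g1 x * fst (X (x, g1 x))" if "x \<in> ball 0 r1" for x
    using g1eq[OF that] X[OF g1U[OF that]] by simp
  note C1 = graph_separatrix[OF r1 g1 this, folded C1_def]
  have "fst (X (g2 y, y)) = deriv g2 y * snd (X (g2 y, y))" if "y \<in> ball 0 r2" for y
    using g2eq[OF that] X[OF g2U[OF that]] by simp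
  note C2 = swapped_graph_separatrix[OF r2 g2 this, folded C2_def]
  have "tangent_line C1 0 \<inter> tangent_line C2 0 \<subseteq> {0}"
    using C1(3) C2(3) by (auto simp: zero_prod_def)
  then have "transverse_at_0 C1 C2"
    using C1(2) C2(2) zero_in_tangent_line[OF C1(2)] zero_in_tangent_line[OF C2(2)] by (auto simp: transverse_at_0_def)
  with C1 C2 part1 show ?thesis by blast
qed

end
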